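(* For every constant $c>0$ there is a constant $C>0$ such that the following holds. For every integer $n\ge 2$ and every real $\epsilon$ with $0<\epsilon\le c$, there is a non-interactive $\epsilon$-$\mathrm{DP}_{\mathrm{shuffle}}$ protocol for binary summation with $n$ users whose root mean squared error is at most $C/\epsilon$ on every input dataset, in which each user sends at most $C\cdot\frac{\log n}{\epsilon}$ messages in expectation, and each message consists of a single bit.
   Context: Shuffle model: a non-interactive protocol $P=(R,S,A)$ for $n$ users consists of a randomized local randomizer $R$ that maps a user's input $x_i$ to a finite multiset of messages, a shuffler $S$ that outputs a uniformly random permutation of all messages sent by all users, and an analyst $A$ that maps the shuffler's output to an estimate; the protocol's output is the analyst's output. Two datasets $D=(x_1,\dots,x_n)$, $D'=(x_1',\dots,x_n')$ are neighboring if they differ in exactly one coordinate. The protocol is $\epsilon$-$\mathrm{DP}_{\mathrm{shuffle}}$ if for all neighboring datasets $D,D'$ and every set $T$ of possible shuffler outputs, $\Pr[S(R(x_1),\dots,R(x_n))\in T]\le e^{\epsilon}\Pr[S(R(x_1'),\dots,R(x_n'))\in T]$. Binary summation: each user $i$ holds $x_i\in\{0,1\}$ and the goal is to estimate $\sum_{i=1}^n x_i$; the mean squared error (MSE) on a dataset is $\mathbb{E}[(\text{output}-\sum_i x_i)^2]$ and the RMSE is its square root. *)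

theory Defs
  imports "HOL-Probability.Probability" "HOL-Combinatorics.Multiset_Permutations"
begin

text \<open>
  Datasets are lists, one entry per user. A local randomizer maps an input to a distribution
  over finite multisets of messages and an analyst maps a shuffled message sequence to an
  estimate. All users run the same randomizer, with independent randomness.
\<close>

type_synonym ('x, 'm) randomizer = "'x \<Rightarrow> 'm multiset pmf"
type_synonym 'm analyst = "'m list \<Rightarrow> real"

text \<open>
  Permuting the messages of a multiset uniformly at random makes all its distinct arrangements
  equally likely, also in the presence of repeated messages.
\<close>

definition shuffler :: "'m multiset \<Rightarrow> 'm list pmf" where
  "shuffler M = pmf_of_set (permutations_of_multiset M)"

definition all_messages :: "('x, 'm) randomizer \<Rightarrow> 'x list \<Rightarrow> 'm multiset pmf" where
  "all_messages R D =
     map_pmf (\<lambda>f. \<Sum>i<length D. f i) (Pi_pmf {..<length D} {#} (\<lambda>i. R (D ! i)))"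

definition shuffled_output :: "('x, 'm) randomizer \<Rightarrow> 'x list \<Rightarrow> 'm list pmf" where
  "shuffled_output R D = bind_pmf (all_messages R D) shuffler"

definition protocol_output :: "('x, 'm) randomizer \<Rightarrow> 'm analyst \<Rightarrow> 'x list \<Rightarrow> real pmf" where
  "protocol_output R A D = map_pmf A (shuffled_output R D)"

definition neighboring :: "'x list \<Rightarrow> 'x list \<Rightarrow> bool" where
  "neighboring D D' \<longleftrightarrow>
     length D = length D' \<and> card {i. i < length D \<and> D ! i \<noteq> D' ! i} = 1"

definition dp_shuffle :: "nat \<Rightarrow> real \<Rightarrow> ('x, 'm) randomizer \<Rightarrow> bool" where
  "dp_shuffle n \<epsilon> R \<longleftrightarrow>
     (\<forall>D D'. length D = n \<and> length D' = n \<and> neighboring D D' \<longrightarrow>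
        (\<forall>T. measure_pmf.prob (shuffled_output R D) T
             \<le> exp \<epsilon> * measure_pmf.prob (shuffled_output R D') T))"

definition true_sum :: "bool list \<Rightarrow> real" where
  "true_sum D = (\<Sum>i<length D. of_bool (D ! i))"

text \<open>
  The Bochner integral of a non-integrable function is 0, so bounds on \<open>mse\<close> and \<open>rmse\<close> are
  meaningful only together with \<open>finite_mse\<close>.
\<close>

definition finite_mse :: "(bool, 'm) randomizer \<Rightarrow> 'm analyst \<Rightarrow> bool list \<Rightarrow> bool" where
  "finite_mse R A D \<longleftrightarrow>
     integrable (measure_pmf (protocol_output R A D)) (\<lambda>y. (y - true_sum D)\<^sup>2)"

definition mse :: "(bool, 'm) randomizer \<Rightarrow> 'm analyst \<Rightarrow> bool list \<Rightarrow> real" where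
  "mse R A D = measure_pmf.expectation (protocol_output R A D) (\<lambda>y. (y - true_sum D)\<^sup>2)"

definition rmse :: "(bool, 'm) randomizer \<Rightarrow> 'm analyst \<Rightarrow> bool list \<Rightarrow> real" where
  "rmse R A D = sqrt (mse R A D)"

end

theory Submission
  imports Defs
begin

text \<open>
  Every user sends exactly \<open>16 s + 1\<close> bits with \<open>s\<close> of order \<open>ln n / \<epsilon>\<close>, so the shuffled view reveals
  only the total number of ones. With probability \<open>1 - \<delta>\<close> the number of ones is the input plus the
  centred difference of two independent truncated negative binomial variables with parameter \<open>1/n\<close>;
  over all users this adds up to nearly discrete Laplace noise, of variance \<open>O(1/\<epsilon>\<^sup>2)\<close>. With the tiny
  probability \<open>\<delta> = 1/n\<^sup>3\<close> it comes, independently of the input, from a wide plateau with exponential edges.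

  Privacy is a coefficientwise inequality between products of generating functions. Multiplication by
  \<open>e\<^sup>\<epsilon> - X\<close> makes discrete Laplace noise nonnegative; truncation leaves a defect near the end of the
  support. The defect of the narrow noise is dominated by what is gained if the user in question
  answers from the plateau, and the defect at the end of one plateau by the interior of the
  convolution of two plateaus.
\<close>

section \<open>Sums of independent variables\<close>

definition pgf :: "nat pmf \<Rightarrow> real fps" where
  "pgf p = Abs_fps (pmf p)"

lemma pgf_nth [simp]: "fps_nth (pgf p) k = pmf p k"
  by (simp add: pgf_def)

lemma pgf_return_0 [simp]: "pgf (return_pmf 0) = 1"
  by (rule fps_ext) (auto simp: pmf_return indicator_def)

lemma pgf_add: "pgf (map_pmf (\<lambda>(a, b). a + b) (pair_pmf p q)) = pgf p * pgf q"
proof (rule fps_ext)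
  fix k :: nat
  have vim: "(\<lambda>(a, b). a + b) -` {k} = (\<lambda>i. (i, k - i)) ` {0..k}"
    by (auto intro!: image_eqI[where x = a for a])
  have "pmf (map_pmf (\<lambda>(a, b). a + b) (pair_pmf p q)) k
        = measure_pmf.prob (pair_pmf p q) ((\<lambda>i. (i, k - i)) ` {0..k})"
    by (simp add: pmf_map vim)
  also have "\<dots> = (\<Sum>x\<in>(\<lambda>i. (i, k - i)) ` {0..k}. pmf (pair_pmf p q) x)"
    by (rule measure_measure_pmf_finite) simp
  also have "\<dots> = (\<Sum>i=0..k. pmf p i * pmf q (k - i))"
    by (subst sum.reindex) (auto simp: inj_on_def pmf_pair)
  finally show "fps_nth (pgf (map_pmf (\<lambda>(a, b). a + b) (pair_pmf p q))) k = fps_nth (pgf p * pgf q) k"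
    by (simp add: fps_mult_nth)
qed

lemma pgf_sum_Pi_pmf:
  assumes "finite I"
  shows "pgf (map_pmf (\<lambda>f. \<Sum>i\<in>I. f i) (Pi_pmf I 0 p)) = (\<Prod>i\<in>I. pgf (p i))"
  using assms
proof (induction I rule: finite_induct)
  case (insert j I)
  have "map_pmf (\<lambda>f. \<Sum>i\<in>insert j I. f i) (Pi_pmf (insert j I) 0 p)
      = map_pmf (\<lambda>(y, f). \<Sum>i\<in>insert j I. (f(j := y)) i) (pair_pmf (p j) (Pi_pmf I 0 p))"
    using insert.hyps(1,2) by (subst Pi_pmf_insert) (simp_all only: map_pmf_comp case_prod_beta' not_False_eq_True)
  also have "\<dots> = map_pmf (\<lambda>(y, f). y + (\<Sum>i\<in>I. f i)) (pair_pmf (p j) (Pi_pmf I 0 p))"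
  proof (rule map_pmf_cong[OF refl], clarify)
    fix y :: nat and f :: "'a \<Rightarrow> nat"
    have "(\<Sum>i\<in>I. (f(j := y)) i) = (\<Sum>i\<in>I. f i)"
      using insert.hyps by (intro sum.cong) auto
    then show "(\<Sum>i\<in>insert j I. (f(j := y)) i) = y + (\<Sum>i\<in>I. f i)"
      using insert.hyps by simp
  qed
  also have "\<dots> = map_pmf (\<lambda>(a, b). a + b) (pair_pmf (p j) (map_pmf (\<lambda>f. \<Sum>i\<in>I. f i) (Pi_pmf I 0 p)))"
    by (simp add: pair_map_pmf2 map_pmf_comp case_prod_beta')
  finally show ?case
    using insert by (simp add: pgf_add)
qed simp

text \<open>A pointwise bound survives any common randomized post-processing. This reduces privacy
  of the shuffled view to a comparison of point masses of the total number of ones.\<close>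

lemma measure_bind_pmf_mono_mult:
  assumes le: "\<And>x. pmf p x \<le> K * pmf q x" and K: "0 \<le> K"
  shows "measure_pmf.prob (bind_pmf p f) T \<le> K * measure_pmf.prob (bind_pmf q f) T"
proof -
  have "emeasure (bind_pmf p f) T = (\<integral>\<^sup>+x. ennreal (pmf p x) * emeasure (f x) T \<partial>count_space UNIV)"
    by (simp add: nn_integral_measure_pmf)
  also have "\<dots> \<le> (\<integral>\<^sup>+x. ennreal K * (ennreal (pmf q x) * emeasure (f x) T) \<partial>count_space UNIV)"
  proof (rule nn_integral_mono)
    fix x
    have "ennreal (pmf p x) \<le> ennreal K * ennreal (pmf q x)"
      using le[of x] K by (simp add: ennreal_mult[symmetric])
    then show "ennreal (pmf p x) * emeasure (f x) T \<le> ennreal K * (ennreal (pmf q x) * emeasure (f x) T)"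
      by (metis mult.assoc mult_right_mono zero_le)
  qed
  also have "\<dots> = ennreal K * emeasure (bind_pmf q f) T"
    by (simp add: nn_integral_cmult nn_integral_measure_pmf)
  finally show ?thesis
    using K by (simp add: measure_pmf.emeasure_eq_measure ennreal_mult[symmetric])
qed

section \<open>Moments of sums of independent variables with finite support\<close>

lemma finite_set_Pi_pmf:
  assumes "finite I" "\<And>i. i \<in> I \<Longrightarrow> finite (set_pmf (p i))"
  shows "finite (set_pmf (Pi_pmf I dflt p))"
  using assms by (simp add: set_Pi_pmf finite_PiE_dflt)

lemma expectation_sum_Pi_pmf:
  fixes \<phi> :: "'i \<Rightarrow> 'a \<Rightarrow> real"
  assumes "finite I" and fin: "\<And>i. i \<in> I \<Longrightarrow> finite (set_pmf (p i))"
  shows "measure_pmf.expectation (Pi_pmf I dflt p) (\<lambda>f. \<Sum>i\<in>I. \<phi> i (f i))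
         = (\<Sum>i\<in>I. measure_pmf.expectation (p i) (\<phi> i))"
proof -
  have "measure_pmf.expectation (Pi_pmf I dflt p) (\<lambda>f. \<Sum>i\<in>I. \<phi> i (f i))
        = (\<Sum>i\<in>I. measure_pmf.expectation (Pi_pmf I dflt p) (\<lambda>f. \<phi> i (f i)))"
    using assms by (intro Bochner_Integration.integral_sum integrable_measure_pmf_finite finite_set_Pi_pmf)
  also have "\<dots> = (\<Sum>i\<in>I. measure_pmf.expectation (map_pmf (\<lambda>f. f i) (Pi_pmf I dflt p)) (\<phi> i))"
    by simp
  also have "\<dots> = (\<Sum>i\<in>I. measure_pmf.expectation (p i) (\<phi> i))"
    using assms by (intro sum.cong refl) (subst Pi_pmf_component, auto)
  finally show ?thesis .
qed

lemma expectation_pair_pmf_times: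
  fixes f :: "'a \<Rightarrow> real" and g :: "'b \<Rightarrow> real"
  assumes "finite (set_pmf p)" "finite (set_pmf q)"
  shows "measure_pmf.expectation (pair_pmf p q) (\<lambda>(a, b). f a * g b)
         = measure_pmf.expectation p f * measure_pmf.expectation q g"
proof -
  have "measure_pmf.expectation (pair_pmf p q) (\<lambda>(a, b). f a * g b)
        = (\<Sum>x\<in>set_pmf p \<times> set_pmf q. pmf (pair_pmf p q) x * (\<lambda>(a, b). f a * g b) x)"
    using assms by (subst integral_measure_pmf[of "set_pmf p \<times> set_pmf q"]) auto
  also have "\<dots> = (\<Sum>a\<in>set_pmf p. \<Sum>b\<in>set_pmf q. (pmf p a * f a) * (pmf q b * g b))"
    by (auto simp: sum.cartesian_product pmf_pair mult_ac intro!: sum.cong)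
  also have "\<dots> = measure_pmf.expectation p f * measure_pmf.expectation q g"
    using assms integral_measure_pmf[of "set_pmf p" p f] integral_measure_pmf[of "set_pmf q" q g]
    by (simp add: sum_product)
  finally show ?thesis .
qed

text \<open>The variables need not be centred, so cross terms survive as products of means; they are
  collected in the square of the summed absolute means. This square will carry the bias caused by
  the plateau.\<close>

lemma second_moment_sum_Pi_pmf_le:
  fixes \<phi> :: "'i \<Rightarrow> 'a \<Rightarrow> real"
  assumes "finite I" and "\<And>i. i \<in> I \<Longrightarrow> finite (set_pmf (p i))"
  shows "measure_pmf.expectation (Pi_pmf I dflt p) (\<lambda>f. (\<Sum>i\<in>I. \<phi> i (f i))\<^sup>2)
         \<le> (\<Sum>i\<in>I. measure_pmf.expectation (p i) (\<lambda>x. (\<phi> i x)\<^sup>2))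
           + (\<Sum>i\<in>I. \<bar>measure_pmf.expectation (p i) (\<phi> i)\<bar>)\<^sup>2"
  using assms
proof (induction I rule: finite_induct)
  case (insert j I)
  let ?P = "Pi_pmf I dflt p" and ?S = "\<lambda>f. \<Sum>i\<in>I. \<phi> i (f i)"
  let ?m = "\<lambda>i. measure_pmf.expectation (p i) (\<phi> i)"
  note fin = insert.prems
  have finp: "finite (set_pmf (p j))" and finP: "finite (set_pmf ?P)"
    using insert by (auto intro: finite_set_Pi_pmf)
  have finpair: "finite (set_pmf (pair_pmf (p j) ?P))"
    using finp finP by simp
  have upd: "(\<Sum>i\<in>I. \<phi> i ((f(j := y)) i)) = ?S f" for f y
    using insert.hyps by (intro sum.cong) auto
  have "measure_pmf.expectation (Pi_pmf (insert j I) dflt p) (\<lambda>f. (\<Sum>i\<in>insert j I. \<phi> i (f i))\<^sup>2)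
      = measure_pmf.expectation (pair_pmf (p j) ?P)
          (\<lambda>x. (\<phi> j (fst x))\<^sup>2 + 2 * (\<lambda>(a, b). \<phi> j a * ?S b) x + (?S (snd x))\<^sup>2)"
  proof -
    have "(\<Sum>i\<in>insert j I. \<phi> i ((f(j := y)) i))\<^sup>2
        = (\<phi> j y)\<^sup>2 + 2 * (\<phi> j y * ?S f) + (?S f)\<^sup>2" for f y
    proof -
      have "(\<Sum>i\<in>insert j I. \<phi> i ((f(j := y)) i)) = \<phi> j y + ?S f"
        using insert.hyps upd[of f y] by simp
      then show ?thesis
        by (simp add: power2_sum)
    qed
    then show ?thesis
      using insert.hyps(1,2) by (subst Pi_pmf_insert) (simp_all only: integral_map_pmf case_prod_beta' not_False_eq_True)
  qed
  \<comment> \<open>By independence the cross term is a product of means.\<close>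
  also have "\<dots> = measure_pmf.expectation (p j) (\<lambda>x. (\<phi> j x)\<^sup>2) + 2 * (?m j * measure_pmf.expectation ?P ?S)
       + measure_pmf.expectation ?P (\<lambda>f. (?S f)\<^sup>2)"
    using expectation_pair_pmf_times[OF finp finP, of "\<phi> j" ?S]
      expectation_pair_pmf_fst[of "p j" ?P "\<lambda>x. (\<phi> j x)\<^sup>2"] expectation_pair_pmf_snd[of "p j" ?P "\<lambda>f. (?S f)\<^sup>2"]
    by (simp add: integrable_measure_pmf_finite[OF finpair])
  also have "measure_pmf.expectation ?P ?S = (\<Sum>i\<in>I. ?m i)"
    using insert.hyps fin by (intro expectation_sum_Pi_pmf) auto
  finally have eq: "measure_pmf.expectation (Pi_pmf (insert j I) dflt p) (\<lambda>f. (\<Sum>i\<in>insert j I. \<phi> i (f i))\<^sup>2)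
    = measure_pmf.expectation (p j) (\<lambda>x. (\<phi> j x)\<^sup>2) + 2 * (?m j * (\<Sum>i\<in>I. ?m i))
       + measure_pmf.expectation ?P (\<lambda>f. (?S f)\<^sup>2)" .
  have "?m j * (\<Sum>i\<in>I. ?m i) \<le> \<bar>?m j\<bar> * \<bar>\<Sum>i\<in>I. ?m i\<bar>"
    by (simp flip: abs_mult)
  also have "\<dots> \<le> \<bar>?m j\<bar> * (\<Sum>i\<in>I. \<bar>?m i\<bar>)"
    by (intro mult_left_mono sum_abs) simp
  finally have cross: "?m j * (\<Sum>i\<in>I. ?m i) \<le> \<bar>?m j\<bar> * (\<Sum>i\<in>I. \<bar>?m i\<bar>)" .
  have IH: "measure_pmf.expectation ?P (\<lambda>f. (?S f)\<^sup>2)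
      \<le> (\<Sum>i\<in>I. measure_pmf.expectation (p i) (\<lambda>x. (\<phi> i x)\<^sup>2)) + (\<Sum>i\<in>I. \<bar>?m i\<bar>)\<^sup>2"
    using insert.IH fin by blast
  have sq: "(\<bar>?m j\<bar> + (\<Sum>i\<in>I. \<bar>?m i\<bar>))\<^sup>2
      = \<bar>?m j\<bar>\<^sup>2 + (\<Sum>i\<in>I. \<bar>?m i\<bar>)\<^sup>2 + 2 * (\<bar>?m j\<bar> * (\<Sum>i\<in>I. \<bar>?m i\<bar>))"
    by (simp only: power2_sum mult.assoc)
  show ?case
    unfolding eq sum.insert[OF insert.hyps, of "\<lambda>i. measure_pmf.expectation (p i) (\<lambda>x. (\<phi> i x)\<^sup>2)"]
      sum.insert[OF insert.hyps, of "\<lambda>i. \<bar>?m i\<bar>"] sq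
    using IH cross zero_le_power2[of "\<bar>?m j\<bar>"] by linarith
qed simp

section \<open>Powers of tapered negative binomial weights\<close>

text \<open>Closure under sums and products is what lets a privacy inequality for one user be
  multiplied by the generating functions of the other users.\<close>

definition fps_nonneg :: "real fps \<Rightarrow> bool" where
  "fps_nonneg f \<longleftrightarrow> (\<forall>k. 0 \<le> fps_nth f k)"

lemma fps_nonneg_nth: "fps_nonneg f \<Longrightarrow> 0 \<le> fps_nth f k"
  by (simp add: fps_nonneg_def)

lemma fps_nonneg_0 [simp]: "fps_nonneg 0"
  and fps_nonneg_1 [simp]: "fps_nonneg 1"
  and fps_nonneg_X [simp]: "fps_nonneg fps_X"
  and fps_nonneg_const [simp]: "fps_nonneg (fps_const c) \<longleftrightarrow> 0 \<le> c"
  by (auto simp: fps_nonneg_def fps_X_def)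

lemma fps_nonneg_add: "fps_nonneg f \<Longrightarrow> fps_nonneg g \<Longrightarrow> fps_nonneg (f + g)"
  by (simp add: fps_nonneg_def)

lemma fps_nonneg_mult: "fps_nonneg f \<Longrightarrow> fps_nonneg g \<Longrightarrow> fps_nonneg (f * g)"
  by (auto simp: fps_nonneg_def fps_mult_nth intro!: sum_nonneg)

lemma fps_nonneg_power: "fps_nonneg f \<Longrightarrow> fps_nonneg (f ^ k)"
  by (induction k) (simp_all add: fps_nonneg_mult)

lemma fps_nonneg_sum: "(\<And>i. i \<in> I \<Longrightarrow> fps_nonneg (f i)) \<Longrightarrow> fps_nonneg (sum f I)"
  by (induction I rule: infinite_finite_induct) (simp_all add: fps_nonneg_add)

lemma fps_nonneg_prod: "(\<And>i. i \<in> I \<Longrightarrow> fps_nonneg (f i)) \<Longrightarrow> fps_nonneg (prod f I)"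
  by (induction I rule: infinite_finite_induct) (simp_all add: fps_nonneg_mult)

lemma fps_nonneg_pgf [simp]: "fps_nonneg (pgf p)"
  by (simp add: fps_nonneg_def)

lemmas fps_nonneg_intros =
  fps_nonneg_add fps_nonneg_mult fps_nonneg_power fps_nonneg_sum fps_nonneg_prod

text \<open>This is the coefficient of \<open>X ^ y\<close> in \<open>1 - X\<close> to the power
  \<open>-1/n\<close>. With the weights \<open>q ^ y\<close> the n-th power of the series is
  therefore the geometric series in \<open>q * X\<close>.\<close>

definition polya :: "nat \<Rightarrow> nat \<Rightarrow> real" where
  "polya n y = (\<Prod>i<y. (real i + 1 / real n) / (real i + 1))"

text \<open>
  The weights \<open>polya n y * q ^ y\<close> are those of the negative binomial distribution with parameter \<open>1/n\<close>.
  Subtracting \<open>q ^ m\<close> lets them vanish at \<open>m\<close> without a jump: a sharp cut-off would leave a defect that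
  is too large by a factor \<open>1/\<epsilon>\<close>.
\<close>

definition taper :: "nat \<Rightarrow> nat \<Rightarrow> real \<Rightarrow> nat \<Rightarrow> real" where
  "taper n m q y = (if y \<le> m then polya n y * (q ^ y - q ^ m) else 0)"

lemma polya_0 [simp]: "polya n 0 = 1"
  by (simp add: polya_def)

lemma polya_Suc: "(real y + 1) * polya n (Suc y) = (real y + 1 / real n) * polya n y"
  by (simp add: polya_def)

lemma polya_nonneg: "0 \<le> polya n y"
  unfolding polya_def by (intro prod_nonneg) auto

lemma polya_pos: "n > 0 \<Longrightarrow> 0 < polya n y"
  unfolding polya_def by (intro prod_pos) (auto intro!: divide_pos_pos add_nonneg_pos)

lemma polya_antimono:
  assumes "n > 0" "x \<le> y"
  shows "polya n y \<le> polya n x"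
  using assms(2)
proof (induction rule: dec_induct)
  case (step k)
  have "(real k + 1 / real n) / (real k + 1) \<le> 1"
    using assms(1) by (simp add: divide_le_eq)
  then have "polya n (Suc k) \<le> polya n k"
    using mult_left_mono[of "(real k + 1 / real n) / (real k + 1)" 1 "polya n k"]
    by (simp add: polya_def[of n "Suc k"] polya_def[of n k, symmetric] polya_nonneg)
  with step.IH show ?case by simp
qed simp

lemma taper_nonneg:
  assumes "0 < q" "q \<le> 1"
  shows "0 \<le> taper n m q y"
  using assms by (auto simp: taper_def polya_nonneg power_decreasing intro!: mult_nonneg_nonneg)

text \<open>The subtracted \<open>q ^ m\<close> perturbs the negative binomial recursion by a small
  nonpositive term only. At \<open>y = m\<close> both sides vanish, since the taper has already
  reached zero there.\<close>

lemma taper_Suc: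
  assumes n: "n > 0"
  shows "(real y + 1) * taper n m q (Suc y) = q * (real y + 1 / real n) * taper n m q y
     - (if y < m then (real y + 1) * polya n (Suc y) * (1 - q) * q ^ m else 0)"
proof (cases "y < m")
  case True
  have "(real y + 1) * taper n m q (Suc y) = ((real y + 1) * polya n (Suc y)) * (q * (q ^ y - q ^ m) - (1 - q) * q ^ m)"
    using True by (simp add: taper_def algebra_simps)
  also have "\<dots> = (real y + 1 / real n) * polya n y * (q * (q ^ y - q ^ m)) - ((real y + 1) * polya n (Suc y)) * ((1 - q) * q ^ m)"
    by (simp only: polya_Suc right_diff_distrib)
  finally show ?thesis
    using True by (simp add: taper_def mult_ac)
qed (auto simp: taper_def)

text \<open>This is \<open>n / k\<close> times the correction in \<open>taper_Suc\<close> at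
  \<open>k - 1\<close>: the factor \<open>n\<close> comes from differentiating an n-th power, the
  division by \<open>k\<close> from returning to the coefficients of the power itself.\<close>

definition taper_defect :: "nat \<Rightarrow> nat \<Rightarrow> real \<Rightarrow> nat \<Rightarrow> real" where
  "taper_defect n m q k = (if 0 < k \<and> k \<le> m then real n * polya n k * (1 - q) * q ^ m else 0)"

text \<open>
  The derivative of \<open>f ^ n\<close> turns the recursion for the coefficients of \<open>f\<close> into one for those of
  \<open>f ^ n\<close> (Panjer's recursion); for parameter \<open>1/n\<close> its main term is exactly geometric.
\<close>

lemma taper_power_smooth:
  fixes m n :: nat
  assumes n: "n > 0" and q: "0 < q" "q \<le> 1"
  defines "f \<equiv> Abs_fps (taper n m q)"
  shows "fps_nonneg ((1 - fps_const q * fps_X) * f ^ n + Abs_fps (taper_defect n m q) * f ^ (n - 1))"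
proof -
  define K where "K = Abs_fps (\<lambda>y. if y < m then (real y + 1) * polya n (Suc y) * (1 - q) * q ^ m else 0)"
  define r where "r = f ^ (n - 1)"
  define p where "p = f ^ n"
  have p_r: "p = f * r"
    using n by (simp add: p_def r_def power_eq_if)
  have f_nn: "fps_nonneg f"
    using taper_nonneg[OF q] by (simp add: f_def fps_nonneg_def)
  then have r_nn: "fps_nonneg r" and p_nn: "fps_nonneg p"
    by (simp_all add: r_def p_def fps_nonneg_power)
  \<comment> \<open>The recursion \<open>taper_Suc\<close>, read as a differential equation for
    \<open>f\<close>.\<close>
  have deriv_f: "(1 - fps_const q * fps_X) * fps_deriv f = fps_const (q / n) * f - K"
  proof (rule fps_ext)
    fix y
    have shift: "fps_nth (fps_X * fps_deriv f) y = real y * taper n m q y"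
      by (cases y) (simp_all add: f_def algebra_simps)
    have "fps_nth ((1 - fps_const q * fps_X) * fps_deriv f) y
        = (real y + 1) * taper n m q (Suc y) - q * (real y * taper n m q y)"
      using shift by (simp add: left_diff_distrib mult.assoc f_def algebra_simps)
    also have "\<dots> = fps_nth (fps_const (q / n) * f - K) y"
      unfolding taper_Suc[OF n] by (simp add: f_def K_def algebra_simps)
    finally show "fps_nth ((1 - fps_const q * fps_X) * fps_deriv f) y = fps_nth (fps_const (q / n) * f - K) y" .
  qed
  \<comment> \<open>The factor \<open>n\<close> of the power rule cancels the parameter
    \<open>1/n\<close>, so \<open>p\<close> gets the coefficient \<open>q\<close>; without
    \<open>K\<close> its coefficients would be exactly geometric.\<close>
  have "(1 - fps_const q * fps_X) * fps_deriv p
      = fps_const (real n) * r * ((1 - fps_const q * fps_X) * fps_deriv f)"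
    unfolding p_def r_def fps_deriv_power by (simp add: mult_ac)
  also have "\<dots> = (fps_const (real n) * fps_const (q / n)) * (f * r) - fps_const (real n) * (K * r)"
    unfolding deriv_f by (simp only: right_diff_distrib mult_ac)
  also have "fps_const (real n) * fps_const (q / n) = fps_const q"
    using n by simp
  finally have deriv_p: "(1 - fps_const q * fps_X) * fps_deriv p = fps_const q * p - fps_const (real n) * (K * r)"
    by (simp add: p_r)
  have "0 \<le> fps_nth ((1 - fps_const q * fps_X) * p + Abs_fps (taper_defect n m q) * r) t" for t
  proof (cases t)
    case 0
    then show ?thesis
      using fps_nonneg_nth[OF p_nn, of 0] by (simp add: taper_defect_def left_diff_distrib)
  next
    case (Suc u)
    have "fps_nth (fps_X * fps_deriv p) u = real u * fps_nth p u"
      by (cases u) simp_all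
    then have "(real u + 1) * fps_nth p (Suc u) - q * (real u * fps_nth p u)
        = q * fps_nth p u - real n * fps_nth (K * r) u"
      using arg_cong[OF deriv_p, of "\<lambda>f. fps_nth f u"]
      by (simp add: left_diff_distrib mult.assoc del: fps_X_mult_nth) (simp add: algebra_simps)
    then have eq: "(real u + 1) * (fps_nth p (Suc u) - q * fps_nth p u) = - (real n * fps_nth (K * r) u)"
      by (simp add: algebra_simps)
    have "real n * fps_nth (K * r) u = (\<Sum>i=0..u. real n * fps_nth K i * fps_nth r (u - i))"
      by (simp add: fps_mult_nth sum_distrib_left mult_ac)
    \<comment> \<open>Enlarging \<open>i + 1\<close> to \<open>u + 1\<close> produces the factor
      that also multiplies the left side of \<open>eq\<close> and can be cancelled.\<close>
    also have "\<dots> \<le> (\<Sum>i=0..u. (real u + 1) * taper_defect n m q (Suc i) * fps_nth r (u - i))"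
    proof (intro sum_mono mult_right_mono fps_nonneg_nth[OF r_nn])
      fix i assume i: "i \<in> {0..u}"
      have "0 \<le> taper_defect n m q (Suc i)"
        using q polya_nonneg by (auto simp: taper_defect_def)
      then have "(real i + 1) * taper_defect n m q (Suc i) \<le> (real u + 1) * taper_defect n m q (Suc i)"
        using i by (intro mult_right_mono) auto
      moreover have "real n * fps_nth K i = (real i + 1) * taper_defect n m q (Suc i)"
        by (auto simp: K_def taper_defect_def)
      ultimately show "real n * fps_nth K i \<le> (real u + 1) * taper_defect n m q (Suc i)"
        by simp
    qed
    also have "\<dots> = (real u + 1) * (\<Sum>i=0..u. taper_defect n m q (Suc i) * fps_nth r (u - i))"
      by (simp add: sum_distrib_left mult_ac)
    also have "(\<Sum>i=0..u. taper_defect n m q (Suc i) * fps_nth r (u - i))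
        = fps_nth (Abs_fps (taper_defect n m q) * r) (Suc u)"
      by (simp add: fps_mult_nth sum.atLeast0_atMost_Suc_shift taper_defect_def del: sum.cl_ivl_Suc)
    finally have "(real u + 1) * (fps_nth p (Suc u) - q * fps_nth p u
        + fps_nth (Abs_fps (taper_defect n m q) * r) (Suc u)) \<ge> 0"
      using eq by (simp add: algebra_simps)
    then have "fps_nth p (Suc u) - q * fps_nth p u + fps_nth (Abs_fps (taper_defect n m q) * r) (Suc u) \<ge> 0"
      by (simp add: zero_le_mult_iff)
    then show ?thesis
      by (simp add: Suc left_diff_distrib mult.assoc)
  qed
  then show ?thesis
    by (simp add: fps_nonneg_def p_def r_def)
qed

section \<open>Narrow and wide noise\<close>

definition normalized_pmf :: "nat \<Rightarrow> (nat \<Rightarrow> real) \<Rightarrow> nat pmf" where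
  "normalized_pmf m w = embed_pmf (\<lambda>k. if k \<le> m then w k / (\<Sum>j\<le>m. w j) else 0)"

lemma pmf_normalized_pmf:
  assumes w: "\<And>k. 0 \<le> w k" and pos: "0 < (\<Sum>j\<le>m. w j)"
  shows "pmf (normalized_pmf m w) k = (if k \<le> m then w k / (\<Sum>j\<le>m. w j) else 0)"
  unfolding normalized_pmf_def
proof (rule pmf_embed_pmf)
  let ?g = "\<lambda>k. if k \<le> m then w k / (\<Sum>j\<le>m. w j) else 0"
  show nn: "0 \<le> ?g k" for k
    using w pos by simp
  have "(\<integral>\<^sup>+k. ennreal (?g k) \<partial>count_space UNIV) = (\<Sum>k\<le>m. ennreal (?g k))"
    by (rule nn_integral_count_space'[of "{..m}"]) auto
  also have "\<dots> = ennreal (\<Sum>k\<le>m. ?g k)"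
    using nn by (intro sum_ennreal)
  also have "(\<Sum>k\<le>m. ?g k) = 1"
    using pos by (simp add: sum_divide_distrib[symmetric])
  finally show "(\<integral>\<^sup>+k. ennreal (?g k) \<partial>count_space UNIV) = 1"
    by simp
qed

lemma set_normalized_pmf:
  assumes "\<And>k. 0 \<le> w k" and "0 < (\<Sum>j\<le>m. w j)"
  shows "set_pmf (normalized_pmf m w) \<subseteq> {..m}"
  using assms by (auto simp: set_pmf_eq pmf_normalized_pmf split: if_splits)

text \<open>A flat envelope for the defects, of which only height and support are tracked.\<close>

definition fps_ones :: "nat \<Rightarrow> real fps" where
  "fps_ones m = Abs_fps (\<lambda>k. if k \<le> m then 1 else 0)"

lemma fps_nonneg_ones [simp]: "fps_nonneg (fps_ones m)"
  by (simp add: fps_ones_def fps_nonneg_def)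

lemma sum_pmf_le_1: "finite S \<Longrightarrow> (\<Sum>i\<in>S. pmf p i) \<le> 1"
  by (simp add: measure_measure_pmf_finite[symmetric])

text \<open>Averaging a block of height 1 with a probability distribution cannot raise it, and the
  supports add.\<close>

lemma fps_ones_times_pgf_le:
  assumes supp: "set_pmf p \<subseteq> {a..b}"
  shows "fps_nth (fps_ones m * pgf p) k \<le> (if a \<le> k \<and> k \<le> m + b then 1 else 0)"
proof -
  have outside: "pmf p i = 0" if "i < a \<or> b < i" for i
    using supp that by (auto simp: set_pmf_eq)
  have eq: "fps_nth (fps_ones m * pgf p) k = (\<Sum>i=0..k. pmf p i * (if k - i \<le> m then 1 else 0))"
    by (subst mult.commute) (simp add: fps_mult_nth fps_ones_def)
  show ?thesis
  proof (cases "a \<le> k \<and> k \<le> m + b")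
    case True
    have "(\<Sum>i=0..k. pmf p i * (if k - i \<le> m then 1 else 0)) \<le> (\<Sum>i=0..k. pmf p i)"
      by (intro sum_mono) auto
    also have "\<dots> \<le> 1"
      by (rule sum_pmf_le_1) simp
    finally show ?thesis
      using True eq by simp
  next
    case False
    have "pmf p i * (if k - i \<le> m then 1 else 0) = 0" if "i \<le> k" for i
    proof (cases "k - i \<le> m")
      case True
      then have "i < a \<or> b < i"
        using False that by linarith
      then show ?thesis
        by (simp add: outside)
    qed simp
    then show ?thesis
      using False eq by (simp add: sum.neutral)
  qed
qed

text \<open>
  The truncated subtractions make the weights constant for \<open>2 s \<le> k \<le> 14 s + 1\<close> and zero beyond \<open>16 s + 1\<close>.
\<close>

definition plateau :: "real \<Rightarrow> nat \<Rightarrow> nat \<Rightarrow> real" where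
  "plateau q s k = q ^ (2 * s - min k (16 * s + 1 - k)) - q ^ (2 * s)"

text \<open>The intended \<open>q\<close> is \<open>exp (-\<epsilon>/2)\<close>: the privacy factor
  is \<open>1/q\<^sup>2\<close> while the weights decay at rate \<open>q\<close> only, which leaves
  a factor \<open>1/q\<close> of slack. The last assumption lets \<open>q ^ s\<close> beat all
  powers of \<open>n\<close> that occur.\<close>

locale noise_parameters =
  fixes n s :: nat and q :: real
  assumes n: "n \<ge> 2" and s: "s > 0" and q: "0 < q" "q < 1"
    and q_small: "q ^ s * real n ^ 11 \<le> 1"
begin

definition taper_mass :: real where
  "taper_mass = (\<Sum>k\<le>2 * s. taper n (2 * s) q k)"

definition plateau_mass :: real where
  "plateau_mass = (\<Sum>k\<le>16 * s + 1. plateau q s k)"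

definition \<delta> :: real where "\<delta> = 1 / real n ^ 3"

definition tap :: "nat pmf" where
  "tap = normalized_pmf (2 * s) (taper n (2 * s) q)"

text \<open>The negative of a second copy, shifted by \<open>8 * s\<close> to stay a natural number.
  The sum \<open>narrow\<close> is then centred at \<open>8 * s\<close> and lives well inside the
  flat part of the plateau.\<close>

definition rev_tap :: "nat pmf" where
  "rev_tap = map_pmf (\<lambda>v. 8 * s - v) tap"

definition narrow :: "nat pmf" where
  "narrow = map_pmf (\<lambda>(u, v). u + v) (pair_pmf tap rev_tap)"

definition wide :: "nat pmf" where
  "wide = normalized_pmf (16 * s + 1) (plateau q s)"

definition num_ones :: "bool \<Rightarrow> nat pmf" where
  "num_ones x = bind_pmf (bernoulli_pmf \<delta>)
     (\<lambda>b. if b then wide else map_pmf (\<lambda>k. of_bool x + k) narrow)"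

lemma delta: "0 < \<delta>" "\<delta> < 1"
  using n by (simp_all add: \<delta>_def power_gt1_lemma one_less_power)

lemma power_q_small: "q ^ s * (128 * real n ^ 4) \<le> 1" "q ^ s * (real n + 1) \<le> 1" "q ^ s \<le> 1 / 2"
proof -
  have n2: "real n \<ge> 2" using n by simp
  \<comment> \<open>Since \<open>128 = 2 ^ 7\<close>, the exponent 11 splits as 7 for the constant
    and 4 for the power of \<open>n\<close>.\<close>
  have "(2::real) ^ 7 \<le> real n ^ 7"
    using n2 by (intro power_mono) auto
  then have "128 * real n ^ 4 \<le> real n ^ 7 * real n ^ 4"
    by (intro mult_right_mono) auto
  then have le: "128 * real n ^ 4 \<le> real n ^ 11"
    by (simp flip: power_add)
  have *: "q ^ s * c \<le> 1" if "c \<le> real n ^ 11" for c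
    using q by (intro order_trans[OF mult_left_mono[OF that] q_small]) simp
  from * le show "q ^ s * (128 * real n ^ 4) \<le> 1" by blast
  have "real n \<le> real n ^ 4"
    using n2 by (intro self_le_power) auto
  with n2 le have "real n + 1 \<le> real n ^ 11" "2 \<le> real n ^ 11"
    by linarith+
  from this[THEN *] show "q ^ s * (real n + 1) \<le> 1" "q ^ s \<le> 1 / 2"
    by simp_all
qed

lemma q2s: "q ^ (2 * s) = q ^ s * q ^ s"
  by (simp add: mult_2 power_add)

lemma q2s_le: "q ^ (2 * s) \<le> q ^ s / 2"
  using power_q_small(3) q by (simp add: q2s mult_left_mono)

text \<open>Only the weights at \<open>1..s\<close> are counted, each bounded by its value near
  \<open>s\<close>. The factor \<open>polya n s\<close> is kept because it cancels against the
  defect in the upper half.\<close>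

lemma taper_mass_ge: "real s * polya n s * q ^ s / 2 \<le> taper_mass"
proof -
  have "real s * polya n s * q ^ s / 2 = (\<Sum>k\<in>{1..s}. polya n s * (q ^ s / 2))"
    by simp
  also have "\<dots> \<le> (\<Sum>k\<in>{1..s}. taper n (2 * s) q k)"
  proof (rule sum_mono)
    fix k assume k: "k \<in> {1..s}"
    have "q ^ s / 2 \<le> q ^ s - q ^ (2 * s)"
      using q2s_le by simp
    also have "\<dots> \<le> q ^ k - q ^ (2 * s)"
      using k q by (simp add: power_decreasing)
    finally have "q ^ s / 2 \<le> q ^ k - q ^ (2 * s)" .
    then have "polya n s * (q ^ s / 2) \<le> polya n k * (q ^ k - q ^ (2 * s))"
      using k n q by (intro mult_mono polya_antimono) (auto simp: polya_nonneg)
    then show "polya n s * (q ^ s / 2) \<le> taper n (2 * s) q k"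
      using k by (simp add: taper_def)
  qed
  also have "\<dots> \<le> taper_mass"
    unfolding taper_mass_def using q by (intro sum_mono2) (auto simp: taper_nonneg)
  finally show ?thesis .
qed

lemma taper_mass_pos: "0 < taper_mass"
proof -
  have "0 < real s * polya n s * q ^ s / 2"
    using n s q by (simp add: polya_pos)
  with taper_mass_ge show ?thesis by linarith
qed

lemma pmf_tap: "pmf tap k = taper n (2 * s) q k / taper_mass"
  using taper_mass_pos q
  by (simp add: tap_def taper_mass_def pmf_normalized_pmf taper_nonneg) (simp add: taper_def)

lemma set_tap: "set_pmf tap \<subseteq> {..2 * s}"
  unfolding tap_def using taper_mass_pos q
  by (intro set_normalized_pmf taper_nonneg) (auto simp: taper_mass_def)

lemma finite_set_tap: "finite (set_pmf tap)"
  using set_tap finite_subset by blast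

lemma set_rev_tap: "set_pmf rev_tap \<subseteq> {6 * s..8 * s}"
  using set_tap by (auto simp: rev_tap_def)

lemma set_narrow: "set_pmf narrow \<subseteq> {6 * s..10 * s}"
  using set_tap set_rev_tap by (fastforce simp: narrow_def)

lemma pgf_narrow: "pgf narrow = pgf tap * pgf rev_tap"
  by (simp add: narrow_def pgf_add)

lemma plateau_nonneg: "0 \<le> plateau q s k"
  using q by (simp add: plateau_def power_decreasing)

lemma plateau_flat:
  assumes "2 * s \<le> k" "k \<le> 14 * s + 1"
  shows "plateau q s k = 1 - q ^ (2 * s)"
  using assms by (simp add: plateau_def)

lemma plateau_mass_le: "plateau_mass \<le> 18 * real s"
proof -
  have "plateau_mass \<le> (\<Sum>k\<le>16 * s + 1. 1)"
    unfolding plateau_mass_def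
  proof (rule sum_mono)
    fix k
    have "q ^ (2 * s - min k (16 * s + 1 - k)) \<le> 1" "0 \<le> q ^ (2 * s)"
      using q by (simp_all add: power_le_one)
    then show "plateau q s k \<le> 1"
      unfolding plateau_def by linarith
  qed
  also have "\<dots> \<le> 18 * real s"
    using s by simp
  finally show ?thesis .
qed

lemma plateau_mass_pos: "0 < plateau_mass"
  unfolding plateau_mass_def
proof (rule sum_pos2)
  show "0 < plateau q s (2 * s)"
    using q s by (simp add: plateau_flat power_less_one_iff)
qed (auto simp: plateau_nonneg)

lemma pmf_wide: "pmf wide k = plateau q s k / plateau_mass"
  unfolding wide_def using plateau_mass_pos
  by (subst pmf_normalized_pmf) (simp_all add: plateau_nonneg plateau_mass_def del: sum.atMost_Suc, simp add: plateau_def)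

lemma set_wide: "set_pmf wide \<subseteq> {..16 * s + 1}"
  unfolding wide_def using plateau_mass_pos
  by (intro set_normalized_pmf plateau_nonneg) (simp only: plateau_mass_def)

lemma finite_set_wide: "finite (set_pmf wide)"
  using set_wide finite_subset by blast

lemma finite_set_narrow: "finite (set_pmf narrow)"
  using set_narrow finite_subset by blast

lemma pmf_wide_flat:
  assumes "2 * s \<le> k" "k \<le> 14 * s + 1"
  shows "1 / (2 * plateau_mass) \<le> pmf wide k"
proof -
  have "1 / 2 \<le> 1 - q ^ (2 * s)"
    using q2s_le power_q_small(3) by simp
  then have "(1 / 2) / plateau_mass \<le> (1 - q ^ (2 * s)) / plateau_mass"
    using plateau_mass_pos by (intro divide_right_mono) auto
  then show ?thesis
    using assms by (simp add: pmf_wide plateau_flat)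
qed

text \<open>The exponent grows by at most one per step, so before \<open>q ^ (2 * s)\<close> is
  subtracted each weight is at least \<open>q\<close> times the previous one. The subtraction costs
  \<open>(1 - q) * q ^ (2 * s)\<close> at each position.\<close>

lemma plateau_smooth:
  "fps_nonneg ((1 - fps_const q * fps_X) * pgf wide
     + fps_const ((1 - q) * q ^ (2 * s) / plateau_mass) * fps_ones (16 * s + 1))"
proof -
  have step: "0 \<le> plateau q s k - q * plateau q s (k - 1) + (if k \<le> 16 * s + 1 then (1 - q) * q ^ (2 * s) else 0)"
    if k: "k > 0" for k
  proof (cases "k \<le> 16 * s + 1")
    case True
    have "2 * s - min k (16 * s + 1 - k) \<le> Suc (2 * s - min (k - 1) (16 * s + 1 - (k - 1)))"
      using k True by linarith
    then have "q ^ Suc (2 * s - min (k - 1) (16 * s + 1 - (k - 1))) \<le> q ^ (2 * s - min k (16 * s + 1 - k))"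
      using q by (intro power_decreasing) auto
    then show ?thesis
      using True by (simp add: plateau_def algebra_simps)
  next
    \<comment> \<open>The weight at \<open>16 * s + 1\<close> is already zero, so leaving the
      support causes no jump.\<close>
    case False
    then show ?thesis
      by (simp add: plateau_def)
  qed
  have "0 \<le> fps_nth ((1 - fps_const q * fps_X) * pgf wide
     + fps_const ((1 - q) * q ^ (2 * s) / plateau_mass) * fps_ones (16 * s + 1)) k" for k
  proof (cases "k = 0")
    case True
    then show ?thesis
      using q plateau_mass_pos by (simp add: left_diff_distrib mult.assoc fps_ones_def)
  next
    case False
    with step[of k] have "0 \<le> (plateau q s k - q * plateau q s (k - 1)
        + (if k \<le> 16 * s + 1 then (1 - q) * q ^ (2 * s) else 0)) / plateau_mass"
      using plateau_mass_pos by simp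
    also have "\<dots> = fps_nth ((1 - fps_const q * fps_X) * pgf wide
     + fps_const ((1 - q) * q ^ (2 * s) / plateau_mass) * fps_ones (16 * s + 1)) k"
      using False by (simp add: left_diff_distrib mult.assoc fps_ones_def pmf_wide add_divide_distrib diff_divide_distrib)
    finally show ?thesis .
  qed
  then show ?thesis
    by (simp add: fps_nonneg_def)
qed

text \<open>The range of \<open>k\<close> is the one over which \<open>narrow\<close> spreads the
  defect of a plateau.\<close>

lemma wide_square_ge:
  assumes k: "6 * s \<le> k" "k \<le> 26 * s + 1"
  shows "real s / (2 * plateau_mass ^ 2) \<le> fps_nth (pgf wide * pgf wide) k"
proof -
  \<comment> \<open>For \<open>i\<close> in \<open>{a..b}\<close> both \<open>i\<close> and
    \<open>k - i\<close> lie in the flat part \<open>{2 * s..14 * s + 1}\<close>; there are at least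
    \<open>2 * s\<close> such \<open>i\<close>.\<close>
  define a b where "a = max (2 * s) (k - (14 * s + 1))" and "b = min (14 * s + 1) (k - 2 * s)"
  have ab: "a + 2 * s \<le> b + 1" "b \<le> k" "2 * s \<le> a" "b \<le> 14 * s + 1"
    using k s unfolding a_def b_def by linarith+
  have flat: "2 * s \<le> k - i" "k - i \<le> 14 * s + 1" if "i \<in> {a..b}" for i
    using that k s unfolding a_def b_def atLeastAtMost_iff by linarith+
  have "real s / (2 * plateau_mass ^ 2) = real (2 * s) * (1 / (2 * plateau_mass) * (1 / (2 * plateau_mass)))"
    by (simp add: power2_eq_square)
  also have "\<dots> \<le> real (card {a..b}) * (1 / (2 * plateau_mass) * (1 / (2 * plateau_mass)))"
    using ab plateau_mass_pos by (intro mult_right_mono) auto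
  also have "\<dots> = (\<Sum>i=a..b. 1 / (2 * plateau_mass) * (1 / (2 * plateau_mass)))"
    by simp
  also have "\<dots> \<le> (\<Sum>i=a..b. pmf wide i * pmf wide (k - i))"
    using ab flat plateau_mass_pos by (intro sum_mono mult_mono pmf_wide_flat) auto
  also have "\<dots> \<le> (\<Sum>i=0..k. pmf wide i * pmf wide (k - i))"
    using ab by (intro sum_mono2) auto
  finally show ?thesis
    by (simp add: fps_mult_nth)
qed

end

section \<open>Smoothness of the noise\<close>

text \<open>The defect \<open>e * U\<close> added to the narrow part is taken back from the wide
  part \<open>k * W\<close>; the total is unchanged.\<close>

lemma gap_regroup:
  fixes a e k v x N P U W :: "'a :: comm_ring_1"
  shows "a * ((v - x) * (N * P) + e * U * P) + (k * W - a * e * U) * P = (a * ((v - x) * N) + k * W) * P"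
  by (simp add: algebra_simps)

text \<open>To be used with \<open>u = q\<close>, \<open>w = 1/q\<close> and
  \<open>v = 1/q\<^sup>2\<close>: \<open>v - x\<close> splits into \<open>w * (1 - u * x)\<close>,
  which suits the plateau, and the slack \<open>v - w\<close>.\<close>

lemma gap_expansion:
  fixes a k w v u c x N W U :: "'a :: comm_ring_1"
  assumes "w * u = 1"
  shows "k * (W * W) - a * (w * c) * (U * N) + a * w * (N * ((1 - u * x) * W + c * U)) + a * (v - w) * (N * W)
     = (a * ((v - x) * N) + k * W) * W"
proof -
  have "a * w * (N * ((1 - u * x) * W + c * U)) = a * N * (w * W - (w * u) * x * W + w * c * U)"
    by (simp add: algebra_simps)
  then show ?thesis
    unfolding assms by (simp add: algebra_simps)
qed

context noise_parameters
begin

text \<open>An upper bound for \<open>1/q\<close> times the normalized defect in the upper half,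
  obtained from \<open>taper_mass_ge\<close>.\<close>

definition \<eta> :: real where
  "\<eta> = (1 - q) / q * (2 * real n * q ^ s / real s)"

lemma eta_pos: "0 < \<eta>"
  using n s q by (simp add: \<eta>_def)

text \<open>
  In the lower half the defect is absorbed by the slack between \<open>e\<^sup>\<epsilon> = 1/q\<^sup>2\<close> and the decay rate \<open>1/q\<close> of
  the weights; only the upper half has to be paid for elsewhere.
\<close>

lemma taper_defect_absorbed:
  "(1 / q) * (taper_defect n (2 * s) q k / taper_mass)
     \<le> (1 / q\<^sup>2 - 1 / q) * pmf tap k + (if k \<le> 2 * s then \<eta> else 0)"
proof (cases "0 < k \<and> k \<le> 2 * s")
  case False
  have "0 \<le> (1 / q\<^sup>2 - 1 / q) * pmf tap k"
    using q by (intro mult_nonneg_nonneg) (auto simp: field_simps power2_eq_square)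
  then show ?thesis
    using False eta_pos by (auto simp: taper_defect_def)
next
  case True
  have gap: "1 / q\<^sup>2 - 1 / q = (1 / q) * ((1 - q) / q)" "0 \<le> (1 - q) / q"
    using q by (simp_all add: field_simps power2_eq_square)
  show ?thesis
  proof (cases "k \<le> s")
    case True
    \<comment> \<open>As \<open>q ^ s * (n + 1)\<close> is at most 1, the constant
      \<open>n * q ^ (2 * s)\<close> stays below \<open>q ^ k - q ^ (2 * s)\<close>. The slack
      \<open>1/q\<^sup>2 - 1/q\<close> has the same factor \<open>1 - q\<close> as the
      defect.\<close>
    have "real n * q ^ (2 * s) + q ^ (2 * s) = q ^ s * (q ^ s * (real n + 1))"
      unfolding q2s by (simp add: algebra_simps)
    also have "\<dots> \<le> q ^ s"
      using power_q_small(2) q by (simp add: mult_left_le)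
    also have "\<dots> \<le> q ^ k"
      using True q by (simp add: power_decreasing)
    finally have "real n * q ^ (2 * s) \<le> q ^ k - q ^ (2 * s)"
      by simp
    then have "(1 / q) * ((1 - q) * polya n k / taper_mass) * (real n * q ^ (2 * s))
        \<le> (1 / q) * ((1 - q) * polya n k / taper_mass) * (q ^ k - q ^ (2 * s))"
      using q taper_mass_pos polya_nonneg[of n k] by (intro mult_left_mono) auto
    also have "\<dots> \<le> (1 / q\<^sup>2) * ((1 - q) * polya n k / taper_mass) * (q ^ k - q ^ (2 * s))"
    proof (intro mult_right_mono)
      show "1 / q \<le> 1 / q\<^sup>2"
        using q by (simp add: field_simps power2_eq_square)
      show "0 \<le> q ^ k - q ^ (2 * s)"
        using True q by (simp add: power_decreasing)
    qed (use q taper_mass_pos polya_nonneg[of n k] in auto)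
    also have "\<dots> = (1 / q\<^sup>2 - 1 / q) * pmf tap k"
      using True q by (simp add: pmf_tap taper_def field_simps power2_eq_square)
    finally show ?thesis
      using True \<open>0 < k \<and> k \<le> 2 * s\<close> eta_pos by (simp add: taper_defect_def mult_ac)
  next
    case False
    \<comment> \<open>Here \<open>polya n k\<close> is at most \<open>polya n s\<close>, which
      cancels against the lower bound for the mass.\<close>
    have "taper_defect n (2 * s) q k / taper_mass
        \<le> real n * polya n s * (1 - q) * q ^ (2 * s) / (real s * polya n s * q ^ s / 2)"
    proof (rule frac_le)
      show "taper_defect n (2 * s) q k \<le> real n * polya n s * (1 - q) * q ^ (2 * s)"
        using False True n q polya_antimono[of n s k]
        by (auto simp: taper_defect_def intro!: mult_right_mono mult_left_mono)
      show "0 < real s * polya n s * q ^ s / 2"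
        using s q n by (simp add: polya_pos)
    qed (use taper_mass_ge q polya_nonneg[of n s] in auto)
    also have "\<dots> = q * \<eta>"
      using s q polya_pos[of n s] n unfolding \<eta>_def q2s by (simp add: field_simps)
    finally have "(1 / q) * (taper_defect n (2 * s) q k / taper_mass) \<le> (1 / q) * (q * \<eta>)"
      using q by (intro mult_left_mono) auto
    moreover have "0 \<le> (1 / q\<^sup>2 - 1 / q) * pmf tap k"
      unfolding gap(1) using gap(2) q by (intro mult_nonneg_nonneg) auto
    ultimately show ?thesis
      using True q by simp
  qed
qed

text \<open>Normalizing \<open>taper_power_smooth\<close> and multiplying by \<open>1/q\<close>
  gives the factor \<open>1/q - X\<close>. Raising it to \<open>1/q\<^sup>2 - X\<close> releases a
  multiple of one factor \<open>pgf tap\<close>, which absorbs the defect up to a flat remainder of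
  height \<open>\<eta>\<close>.\<close>

lemma tap_power_smooth:
  "fps_nonneg ((fps_const (1 / q\<^sup>2) - fps_X) * pgf tap ^ n
     + fps_const \<eta> * fps_ones (2 * s) * pgf tap ^ (n - 1))"
proof -
  define f where "f = Abs_fps (taper n (2 * s) q)"
  define E where "E = Abs_fps (taper_defect n (2 * s) q)"
  define D where "D = fps_const (1 / q) * fps_const (1 / taper_mass)"
  have tap_f: "pgf tap = fps_const (1 / taper_mass) * f"
    by (rule fps_ext) (simp add: f_def pmf_tap)
  have n_eq: "n = Suc (n - 1)"
    using n by simp
  have pow_n: "pgf tap ^ n = pgf tap * pgf tap ^ (n - 1)"
    by (subst n_eq) simp
  have smooth: "fps_nonneg (D * fps_const (1 / taper_mass) ^ (n - 1)
      * ((1 - fps_const q * fps_X) * f ^ n + E * f ^ (n - 1)))"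
    unfolding f_def E_def D_def
    using n q taper_mass_pos
    by (intro fps_nonneg_mult fps_nonneg_power taper_power_smooth) auto
  have "fps_nonneg (fps_const (1 / q\<^sup>2 - 1 / q) * pgf tap + fps_const \<eta> * fps_ones (2 * s) - D * E)"
    unfolding fps_nonneg_def
  proof
    fix k
    show "0 \<le> fps_nth (fps_const (1 / q\<^sup>2 - 1 / q) * pgf tap + fps_const \<eta> * fps_ones (2 * s) - D * E) k"
      using taper_defect_absorbed[of k]
      by (cases "k \<le> 2 * s") (simp_all add: D_def E_def fps_ones_def mult.assoc)
  qed
  then have absorbed: "fps_nonneg ((fps_const (1 / q\<^sup>2 - 1 / q) * pgf tap + fps_const \<eta> * fps_ones (2 * s) - D * E)
      * pgf tap ^ (n - 1))"
    by (intro fps_nonneg_mult fps_nonneg_power) auto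
  have f_n: "fps_const (1 / taper_mass) * fps_const (1 / taper_mass) ^ (n - 1) * f ^ n = pgf tap * pgf tap ^ (n - 1)"
    unfolding tap_f by (subst (3) n_eq) (simp add: power_mult_distrib mult_ac)
  have "D * fps_const (1 / taper_mass) ^ (n - 1) * ((1 - fps_const q * fps_X) * f ^ n + E * f ^ (n - 1))
      = fps_const (1 / q) * (1 - fps_const q * fps_X) * (fps_const (1 / taper_mass) * fps_const (1 / taper_mass) ^ (n - 1) * f ^ n)
        + D * E * (fps_const (1 / taper_mass) * f) ^ (n - 1)"
    by (simp only: D_def distrib_left power_mult_distrib mult_ac)
  also have "\<dots> = fps_const (1 / q) * (1 - fps_const q * fps_X) * pgf tap ^ n + D * E * pgf tap ^ (n - 1)"
    unfolding f_n pow_n tap_f[symmetric] ..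
  finally have eq1: "D * fps_const (1 / taper_mass) ^ (n - 1) * ((1 - fps_const q * fps_X) * f ^ n + E * f ^ (n - 1))
      = fps_const (1 / q) * (1 - fps_const q * fps_X) * pgf tap ^ n + D * E * pgf tap ^ (n - 1)" .
  have "fps_const (1 / q) * (1 - fps_const q * fps_X) = fps_const (1 / q) - fps_const (1 / q * q) * fps_X"
    by (simp only: right_diff_distrib mult_1_right mult.assoc[symmetric] fps_const_mult)
  then have lin: "fps_const (1 / q) * (1 - fps_const q * fps_X) = fps_const (1 / q) - fps_X"
    using q by simp
  have "(fps_const (1 / q\<^sup>2) - fps_X) * pgf tap ^ n + fps_const \<eta> * fps_ones (2 * s) * pgf tap ^ (n - 1)
      = (fps_const (1 / q) * (1 - fps_const q * fps_X) * pgf tap ^ n + D * E * pgf tap ^ (n - 1))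
        + (fps_const (1 / q\<^sup>2 - 1 / q) * pgf tap + fps_const \<eta> * fps_ones (2 * s) - D * E) * pgf tap ^ (n - 1)"
    unfolding lin pow_n by (simp add: algebra_simps flip: fps_const_sub)
  then show ?thesis
    using fps_nonneg_add[OF smooth absorbed] unfolding eq1 by simp
qed

text \<open>Multiply by \<open>pgf rev_tap ^ n\<close>: in the defect term one factor stays with the
  flat block, and the others complete \<open>pgf tap\<close> to \<open>pgf narrow\<close>.\<close>

lemma narrow_power_smooth:
  "fps_nonneg ((fps_const (1 / q\<^sup>2) - fps_X) * pgf narrow ^ n
     + fps_const \<eta> * (fps_ones (2 * s) * pgf rev_tap) * pgf narrow ^ (n - 1))"
proof -
  have pow: "x ^ n = x * x ^ (n - 1)" for x :: "real fps"
    using n by (simp add: power_eq_if)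
  have "(fps_const (1 / q\<^sup>2) - fps_X) * pgf narrow ^ n
     + fps_const \<eta> * (fps_ones (2 * s) * pgf rev_tap) * pgf narrow ^ (n - 1)
     = pgf rev_tap ^ n * ((fps_const (1 / q\<^sup>2) - fps_X) * pgf tap ^ n
        + fps_const \<eta> * fps_ones (2 * s) * pgf tap ^ (n - 1))"
    unfolding pgf_narrow pow power_mult_distrib by (simp only: distrib_left mult_ac)
  then show ?thesis
    using tap_power_smooth by (simp add: fps_nonneg_mult fps_nonneg_power)
qed

text \<open>This is \<open>1/q\<^sup>2\<close> times the generating function for input 0 minus the
  one for input 1, see \<open>dp_gap_eq\<close>.\<close>

definition dp_gap :: "real fps" where
  "dp_gap = fps_const (1 - \<delta>) * ((fps_const (1 / q\<^sup>2) - fps_X) * pgf narrow)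
     + fps_const ((1 / q\<^sup>2 - 1) * \<delta>) * pgf wide"

lemma one_minus_q_le: "(1 - q) / q \<le> 1 / q\<^sup>2 - 1"
  using q by (simp add: field_simps power2_eq_square)

lemma inverse_q_squared: "0 \<le> 1 / q\<^sup>2 - 1"
  using q by (intro order_trans[OF _ one_minus_q_le]) auto

text \<open>The factor \<open>1 / (2 * plateau_mass)\<close> is the guaranteed height of the
  plateau. Since its mass is at most \<open>18 * s\<close>, the claim reduces to
  \<open>72 * n * q ^ s \<le> 1 / n ^ 3\<close>, so \<open>q ^ s\<close> must be of order
  \<open>n ^ (-4)\<close>.\<close>

lemma eta_le: "\<eta> \<le> (1 / q\<^sup>2 - 1) * \<delta> / (2 * plateau_mass)"
proof -
  have "2 * real n * q ^ s / real s * (2 * plateau_mass) \<le> 2 * real n * q ^ s / real s * (2 * (18 * real s))"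
    using plateau_mass_le q by (intro mult_left_mono) auto
  also have "\<dots> = 72 * (real n * q ^ s)"
    using s by simp
  also have "\<dots> \<le> \<delta>"
  proof -
    have "72 * (real n * q ^ s) * real n ^ 3 = q ^ s * (72 * real n ^ 4)"
      by (simp add: eval_nat_numeral)
    also have "\<dots> \<le> q ^ s * (128 * real n ^ 4)"
      using q by (intro mult_left_mono) auto
    also have "\<dots> \<le> 1"
      by (rule power_q_small(1))
    finally show ?thesis
      using n by (simp add: \<delta>_def pos_le_divide_eq)
  qed
  finally have "2 * real n * q ^ s / real s \<le> \<delta> / (2 * plateau_mass)"
    using plateau_mass_pos by (simp add: pos_le_divide_eq)
  then have "(1 - q) / q * (2 * real n * q ^ s / real s) \<le> (1 / q\<^sup>2 - 1) * (\<delta> / (2 * plateau_mass))"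
    using one_minus_q_le q inverse_q_squared by (intro mult_mono) auto
  then show ?thesis
    by (simp add: \<eta>_def)
qed

text \<open>The remaining defect has height at most \<open>\<eta>\<close> and lives on
  \<open>{6 * s..10 * s}\<close>, where the plateau is flat and, by \<open>eta_le\<close>, high
  enough to cover it.\<close>

lemma dp_gap_times_narrow: "fps_nonneg (dp_gap * pgf narrow ^ (n - 1))"
proof -
  have pow: "pgf narrow ^ n = pgf narrow * pgf narrow ^ (n - 1)"
    using n by (simp add: power_eq_if)
  have "fps_nonneg (fps_const ((1 / q\<^sup>2 - 1) * \<delta>) * pgf wide
      - fps_const ((1 - \<delta>) * \<eta>) * (fps_ones (2 * s) * pgf rev_tap))"
    unfolding fps_nonneg_def
  proof
    fix k
    have kap: "0 \<le> (1 / q\<^sup>2 - 1) * \<delta>"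
      using delta inverse_q_squared by (intro mult_nonneg_nonneg) auto
    have ones: "fps_nth (fps_ones (2 * s) * pgf rev_tap) k \<le> (if 6 * s \<le> k \<and> k \<le> 2 * s + 8 * s then 1 else 0)"
      by (rule fps_ones_times_pgf_le[OF set_rev_tap])
    have "(1 - \<delta>) * \<eta> * fps_nth (fps_ones (2 * s) * pgf rev_tap) k \<le> (1 / q\<^sup>2 - 1) * \<delta> * pmf wide k"
    proof (cases "6 * s \<le> k \<and> k \<le> 2 * s + 8 * s")
      case True
      have "(1 - \<delta>) * \<eta> * fps_nth (fps_ones (2 * s) * pgf rev_tap) k \<le> 1 * \<eta> * 1"
        using True ones delta eta_pos
        by (intro mult_mono) (auto intro!: fps_nonneg_nth fps_nonneg_mult)
      also have "\<dots> \<le> (1 / q\<^sup>2 - 1) * \<delta> * (1 / (2 * plateau_mass))"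
        using eta_le by simp
      also have "\<dots> \<le> (1 / q\<^sup>2 - 1) * \<delta> * pmf wide k"
        using True kap by (intro mult_left_mono pmf_wide_flat) auto
      finally show ?thesis .
    next
      case False
      then have "(1 - \<delta>) * \<eta> * fps_nth (fps_ones (2 * s) * pgf rev_tap) k \<le> 0"
        using ones delta eta_pos by (intro mult_nonneg_nonpos) auto
      also have "0 \<le> (1 / q\<^sup>2 - 1) * \<delta> * pmf wide k"
        using kap by simp
      finally show ?thesis .
    qed
    then show "0 \<le> fps_nth (fps_const ((1 / q\<^sup>2 - 1) * \<delta>) * pgf wide
      - fps_const ((1 - \<delta>) * \<eta>) * (fps_ones (2 * s) * pgf rev_tap)) k"
      by simp
  qed
  then have "fps_nonneg (fps_const (1 - \<delta>) * ((fps_const (1 / q\<^sup>2) - fps_X) * pgf narrow ^ n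
     + fps_const \<eta> * (fps_ones (2 * s) * pgf rev_tap) * pgf narrow ^ (n - 1))
     + (fps_const ((1 / q\<^sup>2 - 1) * \<delta>) * pgf wide
      - fps_const ((1 - \<delta>) * \<eta>) * (fps_ones (2 * s) * pgf rev_tap)) * pgf narrow ^ (n - 1))"
    using delta by (intro fps_nonneg_add fps_nonneg_mult fps_nonneg_power narrow_power_smooth) auto
  also have "(fps_const (1 - \<delta>) * ((fps_const (1 / q\<^sup>2) - fps_X) * pgf narrow ^ n
     + fps_const \<eta> * (fps_ones (2 * s) * pgf rev_tap) * pgf narrow ^ (n - 1))
     + (fps_const ((1 / q\<^sup>2 - 1) * \<delta>) * pgf wide
      - fps_const ((1 - \<delta>) * \<eta>) * (fps_ones (2 * s) * pgf rev_tap)) * pgf narrow ^ (n - 1))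
     = dp_gap * pgf narrow ^ (n - 1)"
    unfolding dp_gap_def pow fps_const_mult[symmetric] by (rule gap_regroup)
  finally show ?thesis .
qed

text \<open>\<open>narrow\<close> spreads the defect of the plateau over
  \<open>{6 * s..26 * s + 1}\<close>, exactly where \<open>wide_square_ge\<close> bounds the product
  of two plateaus from below.\<close>

lemma dp_gap_times_wide: "fps_nonneg (dp_gap * pgf wide)"
proof -
  define c where "c = (1 - q) * q ^ (2 * s) / plateau_mass"
  define U where "U = fps_ones (16 * s + 1)"
  have c_nn: "0 \<le> c"
    using q plateau_mass_pos by (simp add: c_def)
  have kap: "0 \<le> (1 / q\<^sup>2 - 1) * \<delta>"
    using delta inverse_q_squared by (intro mult_nonneg_nonneg) auto
  have gap: "0 \<le> 1 / q\<^sup>2 - 1 / q"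
    using q by (simp add: field_simps power2_eq_square)
  have c_le: "c / q \<le> (1 / q\<^sup>2 - 1) * \<delta> * (real s / (2 * plateau_mass ^ 2))"
  proof -
    \<comment> \<open>After \<open>plateau_mass \<le> 18 * s\<close>, one factor
      \<open>q ^ s\<close> is dropped and \<open>36 * q ^ s \<le> \<delta>\<close> remains.\<close>
    have "q ^ (2 * s) * (2 * plateau_mass) \<le> q ^ (2 * s) * (2 * (18 * real s))"
      using plateau_mass_le q by (intro mult_left_mono) auto
    also have "\<dots> = 36 * (q ^ s * q ^ s) * real s"
      by (simp add: q2s)
    also have "\<dots> \<le> 36 * (q ^ s * 1) * real s"
      using q by (intro mult_right_mono mult_left_mono power_le_one) auto
    also have "\<dots> \<le> \<delta> * real s"
    proof (intro mult_right_mono)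
      have "real n ^ 3 \<le> real n ^ 4"
        using n by (intro power_increasing) auto
      then have "36 * real n ^ 3 \<le> 128 * real n ^ 4"
        using zero_le_power[of "real n" 4] by linarith
      then have "q ^ s * (36 * real n ^ 3) \<le> q ^ s * (128 * real n ^ 4)"
        using q by (intro mult_left_mono) auto
      also have "\<dots> \<le> 1"
        by (rule power_q_small(1))
      finally show "36 * (q ^ s * 1) \<le> \<delta>"
        using n by (simp add: \<delta>_def pos_le_divide_eq mult_ac)
    qed simp
    finally have "q ^ (2 * s) / plateau_mass \<le> \<delta> * (real s / (2 * plateau_mass ^ 2))"
      using plateau_mass_pos by (simp add: field_simps power2_eq_square)
    then have "(1 - q) / q * (q ^ (2 * s) / plateau_mass) \<le> (1 / q\<^sup>2 - 1) * (\<delta> * (real s / (2 * plateau_mass ^ 2)))"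
      using one_minus_q_le q plateau_mass_pos inverse_q_squared by (intro mult_mono) auto
    then show ?thesis
      by (simp add: c_def mult_ac)
  qed
  have "fps_nonneg (fps_const ((1 / q\<^sup>2 - 1) * \<delta>) * (pgf wide * pgf wide) - fps_const ((1 - \<delta>) * (c / q)) * (U * pgf narrow))"
    unfolding fps_nonneg_def
  proof
    fix k
    have ones: "fps_nth (U * pgf narrow) k \<le> (if 6 * s \<le> k \<and> k \<le> 16 * s + 1 + 10 * s then 1 else 0)"
      unfolding U_def by (rule fps_ones_times_pgf_le[OF set_narrow])
    have "(1 - \<delta>) * (c / q) * fps_nth (U * pgf narrow) k \<le> (1 / q\<^sup>2 - 1) * \<delta> * fps_nth (pgf wide * pgf wide) k"
    proof (cases "6 * s \<le> k \<and> k \<le> 16 * s + 1 + 10 * s")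
      case True
      have "(1 - \<delta>) * (c / q) * fps_nth (U * pgf narrow) k \<le> 1 * (c / q) * 1"
        using True ones delta c_nn q
        by (intro mult_mono) (auto simp: U_def intro!: fps_nonneg_nth fps_nonneg_mult)
      also have "\<dots> \<le> (1 / q\<^sup>2 - 1) * \<delta> * (real s / (2 * plateau_mass ^ 2))"
        using c_le by simp
      also have "\<dots> \<le> (1 / q\<^sup>2 - 1) * \<delta> * fps_nth (pgf wide * pgf wide) k"
        using True kap by (intro mult_left_mono wide_square_ge) auto
      finally show ?thesis .
    next
      case False
      then have "(1 - \<delta>) * (c / q) * fps_nth (U * pgf narrow) k \<le> 0"
        using ones delta c_nn q by (intro mult_nonneg_nonpos) auto
      also have "0 \<le> (1 / q\<^sup>2 - 1) * \<delta> * fps_nth (pgf wide * pgf wide) k"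
        using kap by (intro mult_nonneg_nonneg[OF kap] fps_nonneg_nth fps_nonneg_mult) auto
      finally show ?thesis .
    qed
    then show "0 \<le> fps_nth (fps_const ((1 / q\<^sup>2 - 1) * \<delta>) * (pgf wide * pgf wide) - fps_const ((1 - \<delta>) * (c / q)) * (U * pgf narrow)) k"
      by simp
  qed
  moreover have "fps_nonneg (fps_const ((1 - \<delta>) * (1 / q)) * (pgf narrow * ((1 - fps_const q * fps_X) * pgf wide + fps_const c * U)))"
    unfolding c_def U_def using delta q
    by (intro fps_nonneg_mult plateau_smooth) auto
  moreover have "fps_nonneg (fps_const ((1 - \<delta>) * (1 / q\<^sup>2 - 1 / q)) * (pgf narrow * pgf wide))"
    using delta gap by (intro fps_nonneg_mult) (auto intro!: mult_nonneg_nonneg)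
  ultimately have "fps_nonneg
     (fps_const ((1 / q\<^sup>2 - 1) * \<delta>) * (pgf wide * pgf wide) - fps_const ((1 - \<delta>) * (c / q)) * (U * pgf narrow)
      + fps_const ((1 - \<delta>) * (1 / q)) * (pgf narrow * ((1 - fps_const q * fps_X) * pgf wide + fps_const c * U))
      + fps_const ((1 - \<delta>) * (1 / q\<^sup>2 - 1 / q)) * (pgf narrow * pgf wide))"
    by (intro fps_nonneg_add)
  also have "fps_const ((1 / q\<^sup>2 - 1) * \<delta>) * (pgf wide * pgf wide) - fps_const ((1 - \<delta>) * (c / q)) * (U * pgf narrow)
      + fps_const ((1 - \<delta>) * (1 / q)) * (pgf narrow * ((1 - fps_const q * fps_X) * pgf wide + fps_const c * U))
      + fps_const ((1 - \<delta>) * (1 / q\<^sup>2 - 1 / q)) * (pgf narrow * pgf wide) = dp_gap * pgf wide"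
  proof -
    have q1: "fps_const (1 / q) * fps_const q = (1 :: real fps)"
      using q by simp
    have c1: "fps_const (c / q) = fps_const (1 / q) * fps_const c"
      by simp
    show ?thesis
      unfolding dp_gap_def fps_const_mult[symmetric] c1 fps_const_sub[symmetric, of "1 / q\<^sup>2" "1 / q"]
      by (rule gap_expansion[OF q1])
  qed
  finally show ?thesis .
qed

end

section \<open>Privacy\<close>

text \<open>The part \<open>W\<close> enters with the same weight \<open>d\<close> for both inputs,
  which leaves \<open>v * d - d\<close> as its coefficient.\<close>

lemma gap_split:
  fixes a v x d N W :: "'a :: comm_ring_1"
  shows "a * ((v - x) * N) + (v * d - d) * W = v * (a * (1 * N) + d * W) - (a * (x * N) + d * W)"
  by (simp add: algebra_simps)

lemma sum_image_mset: "(\<Sum>i\<in>I. image_mset h (f i)) = image_mset h (\<Sum>i\<in>I. f i)"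
  by (induction I rule: infinite_finite_induct) auto

lemma pgf_map_add: "pgf (map_pmf (\<lambda>k. c + k) p) = fps_X ^ c * pgf p"
proof (rule fps_ext)
  fix k
  show "fps_nth (pgf (map_pmf (\<lambda>k. c + k) p)) k = fps_nth (fps_X ^ c * pgf p) k"
  proof (cases "k < c")
    case True
    then have "k \<notin> set_pmf (map_pmf (\<lambda>k. c + k) p)"
      by auto
    then show ?thesis
      using True by (simp add: fps_X_power_mult_nth set_pmf_eq)
  next
    case False
    have "inj (\<lambda>k. c + k)"
      by (simp add: inj_def)
    from pmf_map_inj'[OF this, of p "k - c"] show ?thesis
      using False by (simp add: fps_X_power_mult_nth)
  qed
qed

lemma pmf_map_reflect:
  fixes d :: nat
  assumes supp: "set_pmf p \<subseteq> {..d}" and k: "k \<le> d"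
  shows "pmf (map_pmf (\<lambda>k. d - k) p) k = pmf p (d - k)"
proof (cases "d - k \<in> set_pmf p")
  case True
  have "inj_on (\<lambda>k. d - k) (set_pmf p)"
    using supp by (intro inj_onI) (metis atMost_iff diff_diff_cancel subsetD)
  from pmf_map_inj[OF this True] show ?thesis
    using k by simp
next
  case False
  then have "k \<notin> set_pmf (map_pmf (\<lambda>k. d - k) p)"
    using supp by (auto dest!: subsetD)
  with False show ?thesis
    by (simp add: set_pmf_eq)
qed

text \<open>For a fixed number \<open>d\<close> of bits the multiset carries no information beyond
  the number of ones.\<close>

definition encode :: "nat \<Rightarrow> nat \<Rightarrow> bool multiset" where
  "encode d k = replicate_mset k True + replicate_mset (d - k) False"

lemma size_encode: "k \<le> d \<Longrightarrow> size (encode d k) = d"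
  by (simp add: encode_def)

lemma image_mset_Not_encode: "k \<le> d \<Longrightarrow> image_mset Not (encode d k) = encode d (d - k)"
  by (simp add: encode_def)

lemma sum_encode:
  assumes "finite I" "\<And>i. i \<in> I \<Longrightarrow> f i \<le> d"
  shows "(\<Sum>i\<in>I. encode d (f i)) = encode (card I * d) (\<Sum>i\<in>I. f i)"
  using assms
proof (induction I rule: finite_induct)
  case empty
  then show ?case by (simp add: encode_def)
next
  case (insert j I)
  have le: "(\<Sum>i\<in>I. f i) \<le> card I * d"
    using sum_bounded_above[of I f d] insert.prems by simp
  have j: "f j \<le> d"
    using insert.prems by simp
  \<comment> \<open>Truncated subtraction is additive here because no count exceeds its number of
    bits.\<close>
  have "(d + card I * d) - (f j + (\<Sum>i\<in>I. f i)) = (d - f j) + (card I * d - (\<Sum>i\<in>I. f i))"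
    using le j by simp
  moreover have "replicate_mset (a + b) x = replicate_mset a x + replicate_mset b x" for a b and x :: bool
    by (simp add: multiset_eq_iff)
  moreover have "card (insert j I) * d = d + card I * d"
    using insert.hyps by simp
  moreover have "(\<Sum>i\<in>I. encode d (f i)) = encode (card I * d) (\<Sum>i\<in>I. f i)"
    using insert by simp
  ultimately show ?case
    unfolding sum.insert[OF insert.hyps] by (simp only: encode_def add_ac)
qed

text \<open>An analyst that looks at the multiset only undoes the shuffle, so permutations do not
  enter the error analysis.\<close>

lemma map_pmf_shuffler:
  assumes "\<And>l. A l = a (mset l)"
  shows "map_pmf A (shuffler M) = return_pmf (a M)"
proof -
  have "map_pmf A (shuffler M) = map_pmf (\<lambda>_. a M) (shuffler M)"
    using assms by (intro map_pmf_cong refl) (auto simp: shuffler_def dest: permutations_of_multisetD)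
  then show ?thesis
    by simp
qed

context noise_parameters
begin

lemma tap_le: "u \<in> set_pmf tap \<Longrightarrow> u \<le> 2 * s"
  using set_tap by auto

lemma set_num_ones: "set_pmf (num_ones x) \<subseteq> {..16 * s + 1}"
  using set_narrow set_wide s by (fastforce simp: num_ones_def split: if_splits)

lemma finite_set_num_ones: "finite (set_pmf (num_ones x))"
  using set_num_ones finite_subset by blast

lemma expectation_num_ones:
  "measure_pmf.expectation (num_ones x) h
     = \<delta> * measure_pmf.expectation wide h
       + (1 - \<delta>) * measure_pmf.expectation narrow (\<lambda>k. h (of_bool x + k))" for h :: "nat \<Rightarrow> real"
proof -
  have "measure_pmf.expectation (num_ones x) h
      = (\<Sum>b\<in>UNIV. pmf (bernoulli_pmf \<delta>) b *\<^sub>R measure_pmf.expectation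
          (if b then wide else map_pmf (\<lambda>k. of_bool x + k) narrow) h)"
    unfolding num_ones_def
    by (rule pmf_expectation_bind) (auto simp: finite_set_wide finite_set_narrow)
  then show ?thesis
    using delta by (simp add: UNIV_bool)
qed

lemma pgf_num_ones:
  "pgf (num_ones x) = fps_const (1 - \<delta>) * (fps_X ^ of_bool x * pgf narrow) + fps_const \<delta> * pgf wide"
proof (rule fps_ext)
  fix k
  have "pmf (num_ones x) k = \<delta> * pmf wide k + (1 - \<delta>) * pmf (map_pmf (\<lambda>k. of_bool x + k) narrow) k"
    using delta by (simp add: num_ones_def pmf_bind)
  then show "fps_nth (pgf (num_ones x)) k
      = fps_nth (fps_const (1 - \<delta>) * (fps_X ^ of_bool x * pgf narrow) + fps_const \<delta> * pgf wide) k"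
    by (simp flip: pgf_map_add)
qed

lemma dp_gap_eq: "dp_gap = fps_const (1 / q\<^sup>2) * pgf (num_ones False) - pgf (num_ones True)"
proof -
  have "fps_const ((1 / q\<^sup>2 - 1) * \<delta>) = fps_const (1 / q\<^sup>2) * fps_const \<delta> - fps_const \<delta>"
    by (simp only: left_diff_distrib fps_const_sub[symmetric] fps_const_mult[symmetric] mult_1_left)
  then show ?thesis
    unfolding dp_gap_def pgf_num_ones by (simp only: of_bool_eq power_0 power_one_right gap_split)
qed

text \<open>
  Expand the product over the set of users who answer from \<open>wide\<close>. One such factor already makes
  the gap nonnegative; if there is none, all powers of \<open>narrow\<close> are available.
\<close>

lemma dp_gap_times_prod:
  assumes J: "finite J" "card J = n - 1"
  shows "fps_nonneg (dp_gap * (\<Prod>j\<in>J. pgf (num_ones (x j))))"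
proof -
  let ?a = "\<lambda>j. fps_const (1 - \<delta>) * (fps_X ^ of_bool (x j) * pgf narrow)"
    and ?b = "\<lambda>j. fps_const \<delta> * pgf wide"
  \<comment> \<open>\<open>Y\<close> is the set of users who answer from
    \<open>narrow\<close>.\<close>
  have "fps_nonneg (dp_gap * (prod ?a Y * prod ?b (J - Y)))" if Y: "Y \<subseteq> J" for Y
  proof (cases "Y = J")
    case True
    have "dp_gap * (prod ?a Y * prod ?b (J - Y))
        = (\<Prod>j\<in>J. fps_const (1 - \<delta>) * fps_X ^ of_bool (x j)) * (dp_gap * pgf narrow ^ (n - 1))"
      using True J by (simp add: prod.distrib mult_ac)
    then show ?thesis
      using delta
      by (simp only:) (rule fps_nonneg_mult[OF _ dp_gap_times_narrow], auto intro!: fps_nonneg_intros)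
  next
    case False
    then obtain j where j: "j \<in> J - Y"
      using Y by blast
    then have "prod ?b (J - Y) = (fps_const \<delta> * pgf wide) * prod ?b (J - Y - {j})"
      using J by (intro prod.remove) auto
    then have "dp_gap * (prod ?a Y * prod ?b (J - Y))
        = (prod ?a Y * (fps_const \<delta> * prod ?b (J - Y - {j}))) * (dp_gap * pgf wide)"
      by (simp only: mult_ac)
    then show ?thesis
      using delta
      by (simp only:) (rule fps_nonneg_mult[OF _ dp_gap_times_wide], auto intro!: fps_nonneg_intros)
  qed
  then show ?thesis
    unfolding pgf_num_ones prod_add[OF J(1)] sum_distrib_left
    by (intro fps_nonneg_sum) auto
qed

section \<open>The randomizer and the total number of ones\<close>

definition randomizer :: "(bool, bool) randomizer" where
  "randomizer x = map_pmf (encode (16 * s + 1)) (num_ones x)"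

definition total_ones :: "bool list \<Rightarrow> nat pmf" where
  "total_ones D = map_pmf (\<lambda>f. \<Sum>i<length D. f i) (Pi_pmf {..<length D} 0 (\<lambda>i. num_ones (D ! i)))"

lemma all_messages_randomizer:
  "all_messages randomizer D = map_pmf (encode (length D * (16 * s + 1))) (total_ones D)"
proof -
  let ?d = "16 * s + 1" and ?I = "{..<length D}"
  let ?P = "Pi_pmf ?I 0 (\<lambda>i. num_ones (D ! i))"
  \<comment> \<open>Mapping \<open>encode\<close> over the product needs a default value in its
    image; \<open>{#}\<close> is not one, so the default is changed outside the index set
    first.\<close>
  have "Pi_pmf ?I {#} (\<lambda>i. randomizer (D ! i))
      = map_pmf (\<lambda>f x. if x \<in> ?I then f x else {#}) (Pi_pmf ?I (encode ?d 0) (\<lambda>i. randomizer (D ! i)))"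
    by (rule Pi_pmf_default_swap[symmetric]) simp
  also have "Pi_pmf ?I (encode ?d 0) (\<lambda>i. randomizer (D ! i)) = map_pmf (\<lambda>f. encode ?d \<circ> f) ?P"
    unfolding randomizer_def by (rule Pi_pmf_map) auto
  finally have "all_messages randomizer D = map_pmf (\<lambda>f. \<Sum>i<length D. encode ?d (f i)) ?P"
    by (simp add: all_messages_def map_pmf_comp)
  also have "\<dots> = map_pmf (\<lambda>f. encode (length D * ?d) (\<Sum>i<length D. f i)) ?P"
  proof (rule map_pmf_cong[OF refl])
    fix f assume "f \<in> set_pmf ?P"
    then have "f i \<le> ?d" if "i < length D" for i
      using that set_num_ones[of "D ! i"] by (force simp: set_Pi_pmf PiE_dflt_def)
    then show "(\<Sum>i<length D. encode ?d (f i)) = encode (length D * ?d) (\<Sum>i<length D. f i)"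
      by (subst sum_encode) auto
  qed
  finally show ?thesis
    by (simp add: total_ones_def map_pmf_comp)
qed

section \<open>Symmetry under negation of bits\<close>

lemma reflect_narrow: "map_pmf (\<lambda>k. 16 * s - k) narrow = narrow"
proof -
  have "map_pmf (\<lambda>k. 16 * s - k) narrow
      = map_pmf (\<lambda>(u, v). 16 * s - (u + (8 * s - v))) (pair_pmf tap tap)"
    by (simp add: narrow_def rev_tap_def pair_map_pmf2 map_pmf_comp case_prod_beta')
  \<comment> \<open>Reflection exchanges the roles of the two copies, which are independent and
    identically distributed.\<close>
  also have "\<dots> = map_pmf (\<lambda>(u, v). v + (8 * s - u)) (pair_pmf tap tap)"
    by (intro map_pmf_cong refl) (auto dest!: tap_le)
  also have "\<dots> = map_pmf (\<lambda>(u, v). u + (8 * s - v)) (pair_pmf tap tap)"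
    by (subst pair_commute_pmf) (simp add: map_pmf_comp case_prod_beta')
  also have "\<dots> = narrow"
    by (simp add: narrow_def rev_tap_def pair_map_pmf2 map_pmf_comp case_prod_beta')
  finally show ?thesis .
qed

lemma reflect_wide: "map_pmf (\<lambda>k. 16 * s + 1 - k) wide = wide"
proof (rule pmf_eqI)
  fix k
  show "pmf (map_pmf (\<lambda>k. 16 * s + 1 - k) wide) k = pmf wide k"
  proof (cases "k \<le> 16 * s + 1")
    case True
    then have "plateau q s (16 * s + 1 - k) = plateau q s k"
      by (simp add: plateau_def min.commute)
    then show ?thesis
      using pmf_map_reflect[OF set_wide True] by (simp add: pmf_wide)
  next
    case False
    then have "k \<notin> set_pmf (map_pmf (\<lambda>k. 16 * s + 1 - k) wide)" "k \<notin> set_pmf wide"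
      using set_wide by auto
    then show ?thesis
      by (simp add: set_pmf_eq)
  qed
qed

text \<open>The narrow noise is symmetric about \<open>8 * s\<close>, so the odd number
  \<open>16 * s + 1\<close> of bits makes reflection swap the centres \<open>8 * s\<close> and
  \<open>8 * s + 1\<close> of the two inputs.\<close>

lemma num_ones_Not: "num_ones (\<not> x) = map_pmf (\<lambda>k. 16 * s + 1 - k) (num_ones x)"
proof -
  have "map_pmf (\<lambda>k. 16 * s + 1 - k) (map_pmf (\<lambda>k. of_bool x + k) narrow)
      = map_pmf (\<lambda>k. of_bool (\<not> x) + k) (map_pmf (\<lambda>k. 16 * s - k) narrow)"
    unfolding map_pmf_comp using set_narrow by (intro map_pmf_cong refl) (auto dest!: subsetD)
  then show ?thesis
    unfolding num_ones_def map_bind_pmf using reflect_wide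
    by (intro bind_pmf_cong refl) (auto simp: reflect_narrow)
qed

lemma randomizer_Not: "randomizer (\<not> x) = map_pmf (image_mset Not) (randomizer x)"
proof -
  have "map_pmf (image_mset Not) (randomizer x) = map_pmf (\<lambda>k. encode (16 * s + 1) (16 * s + 1 - k)) (num_ones x)"
    unfolding randomizer_def map_pmf_comp using set_num_ones
    by (intro map_pmf_cong refl image_mset_Not_encode) auto
  then show ?thesis
    by (simp add: randomizer_def num_ones_Not map_pmf_comp)
qed

text \<open>By this symmetry it suffices for privacy to bound the view for input 1 by the view for
  input 0.\<close>

lemma all_messages_map_Not:
  "all_messages randomizer (map Not D) = map_pmf (image_mset Not) (all_messages randomizer D)"
proof -
  have "Pi_pmf {..<length D} {#} (\<lambda>i. randomizer (map Not D ! i))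
      = Pi_pmf {..<length D} {#} (\<lambda>i. map_pmf (image_mset Not) (randomizer (D ! i)))"
    by (intro Pi_pmf_cong) (auto simp: randomizer_Not)
  also have "\<dots> = map_pmf (\<lambda>f. image_mset Not \<circ> f) (Pi_pmf {..<length D} {#} (\<lambda>i. randomizer (D ! i)))"
    by (rule Pi_pmf_map) auto
  finally show ?thesis
    by (simp add: all_messages_def map_pmf_comp sum_image_mset)
qed

section \<open>Comparison of neighboring datasets\<close>

lemma pgf_total_ones: "pgf (total_ones D) = (\<Prod>i<length D. pgf (num_ones (D ! i)))"
  unfolding total_ones_def by (rule pgf_sum_Pi_pmf) simp

text \<open>The two generating functions share every factor except that of user \<open>i\<close>, so
  their weighted difference is \<open>dp_gap\<close> times the remaining \<open>n - 1\<close>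
  factors.\<close>

lemma pmf_total_ones_le:
  assumes len: "length D = n" "length D' = n" and i: "i < n" "D ! i" "\<not> D' ! i"
    and same: "\<And>j. j < n \<Longrightarrow> j \<noteq> i \<Longrightarrow> D ! j = D' ! j"
  shows "pmf (total_ones D) k \<le> 1 / q\<^sup>2 * pmf (total_ones D') k"
proof -
  define J where "J = {..<n} - {i}"
  have J: "finite J" "card J = n - 1"
    using i by (simp_all add: J_def)
  define Q where "Q = (\<Prod>j\<in>J. pgf (num_ones (D ! j)))"
  have Q': "Q = (\<Prod>j\<in>J. pgf (num_ones (D' ! j)))"
    unfolding Q_def using same by (intro prod.cong) (auto simp: J_def)
  have D: "pgf (total_ones D) = pgf (num_ones True) * Q"
    using i len by (simp add: pgf_total_ones prod.remove[of "{..<n}" i] Q_def J_def)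
  have D': "pgf (total_ones D') = pgf (num_ones False) * Q"
    using i len by (simp add: pgf_total_ones prod.remove[of "{..<n}" i] Q' J_def)
  have "fps_nonneg (dp_gap * Q)"
    unfolding Q_def by (rule dp_gap_times_prod[OF J])
  also have "dp_gap * Q = fps_const (1 / q\<^sup>2) * pgf (total_ones D') - pgf (total_ones D)"
    unfolding dp_gap_eq D D' by (simp add: left_diff_distrib mult.assoc)
  finally have "0 \<le> fps_nth (fps_const (1 / q\<^sup>2) * pgf (total_ones D') - pgf (total_ones D)) k"
    by (rule fps_nonneg_nth)
  then show ?thesis
    by simp
qed

lemma pmf_all_messages_le_up:
  assumes "length D = n" "length D' = n" "i < n" "D ! i" "\<not> D' ! i"
    and "\<And>j. j < n \<Longrightarrow> j \<noteq> i \<Longrightarrow> D ! j = D' ! j"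
  shows "pmf (all_messages randomizer D) M \<le> 1 / q\<^sup>2 * pmf (all_messages randomizer D') M"
proof -
  have "measure_pmf.prob (all_messages randomizer D) {M} \<le> 1 / q\<^sup>2 * measure_pmf.prob (all_messages randomizer D') {M}"
    unfolding all_messages_randomizer map_pmf_def assms(1,2)
    by (intro measure_bind_pmf_mono_mult pmf_total_ones_le[of D D' i]) (use assms in auto)
  then show ?thesis
    by (simp add: measure_pmf_single)
qed

lemma dp_shuffle_randomizer: "dp_shuffle n (ln (1 / q\<^sup>2)) randomizer"
  unfolding dp_shuffle_def
proof (intro allI impI)
  fix D D' :: "bool list" and T
  assume "length D = n \<and> length D' = n \<and> neighboring D D'"
  then have len: "length D = n" "length D' = n" and "card {i. i < n \<and> D ! i \<noteq> D' ! i} = 1"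
    by (auto simp: neighboring_def)
  then obtain i where "{i. i < n \<and> D ! i \<noteq> D' ! i} = {i}"
    using card_1_singletonE by blast
  then have i: "i < n" "D ! i \<noteq> D' ! i" and same: "\<And>j. j < n \<Longrightarrow> j \<noteq> i \<Longrightarrow> D ! j = D' ! j"
    by auto
  have "pmf (all_messages randomizer D) M \<le> 1 / q\<^sup>2 * pmf (all_messages randomizer D') M" for M
  proof (cases "D ! i")
    case True
    with len i same show ?thesis
      by (intro pmf_all_messages_le_up[of D D' i]) auto
  next
    case False
    \<comment> \<open>Negating all inputs leads to the direction already treated, and negating the
      messages is injective, hence preserves point masses.\<close>
    have inj: "inj (image_mset Not)"
      by (rule inj_on_inverseI[where g = "image_mset Not"]) (simp add: image_mset.compositionality comp_def)
    have flip: "pmf (all_messages randomizer (map Not B)) (image_mset Not M) = pmf (all_messages randomizer B) M" for B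
      unfolding all_messages_map_Not by (rule pmf_map_inj'[OF inj])
    have "pmf (all_messages randomizer (map Not D)) (image_mset Not M)
        \<le> 1 / q\<^sup>2 * pmf (all_messages randomizer (map Not D')) (image_mset Not M)"
      using False len i same by (intro pmf_all_messages_le_up[of _ _ i]) auto
    then show ?thesis
      by (simp only: flip)
  qed
  then have "measure_pmf.prob (shuffled_output randomizer D) T
      \<le> 1 / q\<^sup>2 * measure_pmf.prob (shuffled_output randomizer D') T"
    unfolding shuffled_output_def by (rule measure_bind_pmf_mono_mult) simp
  also have "1 / q\<^sup>2 = exp (ln (1 / q\<^sup>2))"
    using q by simp
  finally show "measure_pmf.prob (shuffled_output randomizer D) T
      \<le> exp (ln (1 / q\<^sup>2)) * measure_pmf.prob (shuffled_output randomizer D') T" .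
qed

end

section \<open>Accuracy\<close>

context noise_parameters
begin

text \<open>Without its nonpositive correction \<open>taper_Suc\<close> bounds each unnormalized
  moment \<open>S (Suc a)\<close> by \<open>q\<close> times itself plus lower moments. The factor
  \<open>1/n\<close> keeps the total second moment over \<open>n\<close> users independent of
  \<open>n\<close>.\<close>

lemma taper_moments:
  defines "S \<equiv> \<lambda>a. \<Sum>y\<le>2 * s. real y ^ a * taper n (2 * s) q y"
  shows "(1 - q)\<^sup>2 * S 2 \<le> 3 / real n * S 0"
proof -
  let ?T = "taper n (2 * s) q"
  have Suc_le: "(real y + 1) * ?T (Suc y) \<le> q * (real y + 1 / real n) * ?T y" for y
    using n q polya_nonneg[of n "Suc y"] by (subst taper_Suc) auto
  \<comment> \<open>The term at 0 drops out, and one factor \<open>y + 1\<close> is spent on the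
    recursion.\<close>
  have shift: "S (Suc a) \<le> (\<Sum>y\<le>2 * s. (real y + 1) ^ a * (q * (real y + 1 / real n) * ?T y))" for a
  proof -
    have "S (Suc a) = (\<Sum>y<2 * s. (real y + 1) ^ a * ((real y + 1) * ?T (Suc y)))"
      unfolding S_def by (simp add: sum.atMost_shift mult_ac add_ac)
    also have "\<dots> \<le> (\<Sum>y<2 * s. (real y + 1) ^ a * (q * (real y + 1 / real n) * ?T y))"
      using Suc_le by (intro sum_mono mult_left_mono) auto
    also have "\<dots> \<le> (\<Sum>y\<le>2 * s. (real y + 1) ^ a * (q * (real y + 1 / real n) * ?T y))"
      using q taper_nonneg[of q n "2 * s"] by (intro sum_mono2) auto
    finally show ?thesis .
  qed
  have S_nonneg: "0 \<le> S a" for a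
    unfolding S_def using q by (intro sum_nonneg mult_nonneg_nonneg taper_nonneg) auto
  have "S 1 \<le> q * (S 1 + S 0 / real n)"
    using shift[of 0] by (simp add: S_def sum_distrib_left sum_divide_distrib sum.distrib algebra_simps)
  also have "\<dots> \<le> q * S 1 + S 0 / real n"
    using q S_nonneg[of 0] mult_left_le_one_le[of "S 0 / real n" q] by (simp add: distrib_left)
  finally have S1: "(1 - q) * S 1 \<le> S 0 / real n"
    by (simp add: algebra_simps)
  have "S 2 \<le> (\<Sum>y\<le>2 * s. (real y + 1) * (q * (real y + 1 / real n) * ?T y))"
    using shift[of 1] by (simp add: numeral_2_eq_2)
  also have "\<dots> = q * (S 2 + (1 + 1 / real n) * S 1 + S 0 / real n)"
    by (simp add: S_def sum_distrib_left sum_divide_distrib sum.distrib[symmetric] algebra_simps add_divide_distrib power2_eq_square)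
  also have "\<dots> \<le> q * S 2 + (2 * S 1 + S 0 / real n)"
  proof -
    have "(1 + 1 / real n) * S 1 \<le> 2 * S 1"
      using n S_nonneg[of 1] by (intro mult_right_mono) simp_all
    moreover have "q * ((1 + 1 / real n) * S 1 + S 0 / real n) \<le> (1 + 1 / real n) * S 1 + S 0 / real n"
      using q S_nonneg[of 1] S_nonneg[of 0] by (intro mult_left_le_one_le) simp_all
    ultimately show ?thesis
      unfolding add.assoc distrib_left[of q "S 2"] by linarith
  qed
  finally have "(1 - q) * S 2 \<le> 2 * S 1 + S 0 / real n"
    by (simp add: algebra_simps)
  then have "(1 - q) * ((1 - q) * S 2) \<le> (1 - q) * (2 * S 1 + S 0 / real n)"
    using q by (intro mult_left_mono) auto
  also have "\<dots> = 2 * ((1 - q) * S 1) + (1 - q) * (S 0 / real n)"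
    by (simp only: distrib_left mult.left_commute)
  also have "\<dots> \<le> 3 / real n * S 0"
  proof -
    have "(1 - q) * (S 0 / real n) \<le> S 0 / real n"
      using q S_nonneg[of 0] by (intro mult_left_le_one_le) simp_all
    then show ?thesis
      using S1 by simp
  qed
  finally show ?thesis
    by (simp add: power2_eq_square mult.assoc)
qed

lemma tap_second_moment:
  "measure_pmf.expectation tap (\<lambda>k. (real k)\<^sup>2) \<le> 3 / (real n * (1 - q)\<^sup>2)"
proof -
  have "measure_pmf.expectation tap (\<lambda>k. (real k)\<^sup>2)
      = (\<Sum>k\<le>2 * s. (real k)\<^sup>2 * pmf tap k)"
    using set_tap by (intro integral_measure_pmf_real) auto
  also have "\<dots> = (\<Sum>k\<le>2 * s. (real k)\<^sup>2 * taper n (2 * s) q k) / taper_mass"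
    by (simp add: pmf_tap sum_divide_distrib)
  also have "\<dots> \<le> 3 / (real n * (1 - q)\<^sup>2)"
    using taper_moments taper_mass_pos n q
    by (simp add: taper_mass_def field_simps)
  finally show ?thesis .
qed

lemma narrow_eq: "narrow = map_pmf (\<lambda>(u, v). u + (8 * s - v)) (pair_pmf tap tap)"
  by (simp add: narrow_def rev_tap_def pair_map_pmf2 map_pmf_comp case_prod_beta')

text \<open>Up to the shift, \<open>narrow\<close> is a difference of two independent copies of
  \<open>tap\<close>: its mean vanishes exactly, and its square is at most the sum of the two
  squares since both are nonnegative.\<close>

lemma narrow_moments:
  "measure_pmf.expectation narrow (\<lambda>k. real k - 8 * real s) = 0"
  "measure_pmf.expectation narrow (\<lambda>k. (real k - 8 * real s)\<^sup>2) \<le> 6 / (real n * (1 - q)\<^sup>2)"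
proof -
  let ?P = "pair_pmf tap tap"
  have int: "integrable (measure_pmf ?P) h" for h :: "nat \<times> nat \<Rightarrow> real"
    by (rule integrable_measure_pmf_finite) (simp add: finite_set_tap)
  have shift: "measure_pmf.expectation narrow (\<lambda>k. h (real k - 8 * real s))
      = measure_pmf.expectation ?P (\<lambda>x. h (real (fst x) - real (snd x)))" for h :: "real \<Rightarrow> real"
    unfolding narrow_eq integral_map_pmf
    by (intro integral_cong_AE) (auto simp: AE_measure_pmf_iff of_nat_diff dest!: tap_le)
  have "measure_pmf.expectation narrow (\<lambda>k. real k - 8 * real s)
      = measure_pmf.expectation ?P (\<lambda>x. real (fst x)) - measure_pmf.expectation ?P (\<lambda>x. real (snd x))"
    unfolding shift[of "\<lambda>x. x"] by (rule Bochner_Integration.integral_diff[OF int int])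
  also have "\<dots> = 0"
    by (simp only: expectation_pair_pmf_fst[of tap tap real] expectation_pair_pmf_snd[of tap tap real])
  finally show "measure_pmf.expectation narrow (\<lambda>k. real k - 8 * real s) = 0" .
  have "measure_pmf.expectation narrow (\<lambda>k. (real k - 8 * real s)\<^sup>2)
      \<le> measure_pmf.expectation ?P (\<lambda>x. (real (fst x))\<^sup>2 + (real (snd x))\<^sup>2)"
    unfolding shift[of "\<lambda>x. x\<^sup>2"] by (intro integral_mono int) (simp add: power2_diff)
  also have "\<dots> = measure_pmf.expectation ?P (\<lambda>x. (real (fst x))\<^sup>2) + measure_pmf.expectation ?P (\<lambda>x. (real (snd x))\<^sup>2)"
    by (rule Bochner_Integration.integral_add[OF int int])
  also have "\<dots> = 2 * measure_pmf.expectation tap (\<lambda>k. (real k)\<^sup>2)"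
    by (simp only: expectation_pair_pmf_fst[of tap tap "\<lambda>k. (real k)\<^sup>2"] expectation_pair_pmf_snd[of tap tap "\<lambda>k. (real k)\<^sup>2"])
  also have "\<dots> \<le> 6 / (real n * (1 - q)\<^sup>2)"
    using tap_second_moment by simp
  finally show "measure_pmf.expectation narrow (\<lambda>k. (real k - 8 * real s)\<^sup>2) \<le> 6 / (real n * (1 - q)\<^sup>2)" .
qed

section \<open>Bias and second moment of the error\<close>

definition user_error :: "bool \<Rightarrow> nat \<Rightarrow> real" where
  "user_error x k = real k - 8 * real s - of_bool x"

lemma wide_error_bounded:
  assumes "k \<in> set_pmf wide"
  shows "\<bar>user_error x k\<bar> \<le> 9 * real s"
proof -
  have "k \<le> 16 * s + 1"
    using assms set_wide by auto
  then have "real k \<le> 16 * real s + 1" "1 \<le> real s"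
    using s by linarith+
  then show ?thesis
    by (cases x) (auto simp: user_error_def abs_le_iff)
qed

lemma expectation_user_error:
  "measure_pmf.expectation (num_ones x) (\<lambda>k. h (user_error x k))
    = \<delta> * measure_pmf.expectation wide (\<lambda>k. h (user_error x k))
      + (1 - \<delta>) * measure_pmf.expectation narrow (\<lambda>k. h (real k - 8 * real s))" for h :: "real \<Rightarrow> real"
  unfolding expectation_num_ones by (simp add: user_error_def)

text \<open>Only answers from the plateau are biased, as the narrow noise is centred.\<close>

lemma abs_mean_user_error:
  "\<bar>measure_pmf.expectation (num_ones x) (user_error x)\<bar> \<le> \<delta> * (9 * real s)"
proof -
  have "\<bar>measure_pmf.expectation wide (user_error x)\<bar> \<le> measure_pmf.expectation wide (\<lambda>k. \<bar>user_error x k\<bar>)"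
    by (rule integral_abs_bound)
  also have "\<dots> \<le> 9 * real s"
    by (intro measure_pmf.integral_le_const integrable_measure_pmf_finite finite_set_wide)
      (simp add: AE_measure_pmf_iff wide_error_bounded)
  finally show ?thesis
    using expectation_user_error[of x "\<lambda>e. e"] narrow_moments(1) delta
    by (simp add: abs_mult mult_left_mono)
qed

lemma second_moment_user_error:
  "measure_pmf.expectation (num_ones x) (\<lambda>k. (user_error x k)\<^sup>2)
     \<le> 6 / (real n * (1 - q)\<^sup>2) + \<delta> * (9 * real s)\<^sup>2"
proof -
  have "measure_pmf.expectation wide (\<lambda>k. (user_error x k)\<^sup>2) \<le> (9 * real s)\<^sup>2"
  proof (intro measure_pmf.integral_le_const integrable_measure_pmf_finite finite_set_wide)
    have "(user_error x k)\<^sup>2 \<le> (9 * real s)\<^sup>2" if "k \<in> set_pmf wide" for k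
      using power_mono[OF wide_error_bounded[OF that, of x] abs_ge_zero, of 2] by simp
    then show "AE k in measure_pmf wide. (user_error x k)\<^sup>2 \<le> (9 * real s)\<^sup>2"
      by (simp add: AE_measure_pmf_iff)
  qed
  then have "\<delta> * measure_pmf.expectation wide (\<lambda>k. (user_error x k)\<^sup>2) \<le> \<delta> * (9 * real s)\<^sup>2"
    using delta by (intro mult_left_mono) auto
  moreover have "(1 - \<delta>) * measure_pmf.expectation narrow (\<lambda>k. (real k - 8 * real s)\<^sup>2)
      \<le> 1 * (6 / (real n * (1 - q)\<^sup>2))"
    using delta narrow_moments(2) by (intro mult_mono) auto
  ultimately show ?thesis
    using expectation_user_error[of x "\<lambda>e. e\<^sup>2"] by simp
qed

text \<open>Removes the centres of the narrow noise; the small bias from the plateau is left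
  uncorrected.\<close>

definition analyst :: "bool analyst" where
  "analyst l = real (count (mset l) True) - 8 * real s * real n"

lemma count_encode: "count (encode d k) True = k"
  by (simp add: encode_def)

lemma protocol_output_eq:
  "protocol_output randomizer analyst D = map_pmf (\<lambda>k. real k - 8 * real s * real n) (total_ones D)"
proof -
  have "map_pmf analyst (shuffler M) = return_pmf (real (count M True) - 8 * real s * real n)" for M
    by (rule map_pmf_shuffler) (simp add: analyst_def)
  then show ?thesis
    by (simp add: protocol_output_def shuffled_output_def map_bind_pmf all_messages_randomizer
        bind_map_pmf count_encode map_pmf_def[symmetric])
qed

lemma finite_set_total_ones: "finite (set_pmf (total_ones D))"
  unfolding total_ones_def by (simp add: finite_set_Pi_pmf finite_set_num_ones)

lemma finite_mse_protocol: "finite_mse randomizer analyst D"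
  unfolding finite_mse_def protocol_output_eq
  by (intro integrable_measure_pmf_finite) (simp add: finite_set_total_ones)

text \<open>The narrow noise contributes the first term. With \<open>\<delta> = 1 / n ^ 3\<close>
  the plateau adds \<open>n * \<delta> * (9 * s)\<^sup>2\<close> to the second moments and
  \<open>(n * \<delta> * 9 * s)\<^sup>2\<close> as squared bias, each at most
  \<open>81 * (s / n)\<^sup>2\<close>.\<close>

lemma mse_protocol_le:
  assumes len: "length D = n"
  shows "mse randomizer analyst D \<le> 6 / (1 - q)\<^sup>2 + 162 * (real s / real n)\<^sup>2"
proof -
  let ?P = "Pi_pmf {..<n} 0 (\<lambda>i. num_ones (D ! i))"
  have err: "real (\<Sum>i<n. f i) - 8 * real s * real n - true_sum D = (\<Sum>i<n. user_error (D ! i) (f i))" for f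
    using len by (simp add: true_sum_def user_error_def sum_subtractf)
  have "mse randomizer analyst D
      = measure_pmf.expectation ?P (\<lambda>f. (\<Sum>i<n. user_error (D ! i) (f i))\<^sup>2)"
    unfolding mse_def protocol_output_eq total_ones_def len integral_map_pmf err ..
  also have "\<dots> \<le> (\<Sum>i<n. measure_pmf.expectation (num_ones (D ! i)) (\<lambda>k. (user_error (D ! i) k)\<^sup>2))
      + (\<Sum>i<n. \<bar>measure_pmf.expectation (num_ones (D ! i)) (user_error (D ! i))\<bar>)\<^sup>2"
    by (rule second_moment_sum_Pi_pmf_le) (simp_all add: finite_set_num_ones)
  also have "\<dots> \<le> (\<Sum>i<n. 6 / (real n * (1 - q)\<^sup>2) + \<delta> * (9 * real s)\<^sup>2) + (\<Sum>i<n. \<delta> * (9 * real s))\<^sup>2"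
    by (intro add_mono power_mono sum_mono second_moment_user_error abs_mean_user_error) (simp add: sum_nonneg)
  also have "\<dots> = 6 / (1 - q)\<^sup>2 + 81 * (real s / real n)\<^sup>2 + 81 * (real s / (real n)\<^sup>2)\<^sup>2"
  proof -
    have "real n * (6 / (real n * (1 - q)\<^sup>2)) = 6 / (1 - q)\<^sup>2"
      using n by simp
    moreover have "real n * (\<delta> * (9 * real s)\<^sup>2) = 81 * (real s / real n)\<^sup>2"
      using n by (simp add: \<delta>_def field_simps eval_nat_numeral)
    moreover have "real n * (\<delta> * (9 * real s)) = 9 * (real s / (real n)\<^sup>2)"
      using n by (simp add: \<delta>_def field_simps eval_nat_numeral)
    ultimately show ?thesis
      by (simp only: sum_constant card_lessThan distrib_left power_mult_distrib) simp
  qed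
  also have "(real s / (real n)\<^sup>2)\<^sup>2 \<le> (real s / real n)\<^sup>2"
  proof (rule power_mono)
    have "real n \<le> (real n)\<^sup>2"
      using n by (intro self_le_power) auto
    then show "real s / (real n)\<^sup>2 \<le> real s / real n"
      using n by (intro divide_left_mono) auto
  qed simp
  finally show ?thesis
    by simp
qed

lemma expected_messages:
  "integrable (measure_pmf (randomizer x)) (\<lambda>M. real (size M))"
  "measure_pmf.expectation (randomizer x) (\<lambda>M. real (size M)) = 16 * real s + 1"
proof -
  show "integrable (measure_pmf (randomizer x)) (\<lambda>M. real (size M))"
    by (intro integrable_measure_pmf_finite) (simp add: randomizer_def finite_set_num_ones)
  have "measure_pmf.expectation (randomizer x) (\<lambda>M. real (size M))
      = measure_pmf.expectation (num_ones x) (\<lambda>k. real (16 * s + 1))"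
    unfolding randomizer_def integral_map_pmf using set_num_ones[of x]
    by (intro integral_cong_AE) (auto simp: AE_measure_pmf_iff size_encode simp del: of_nat_add of_nat_Suc)
  then show "measure_pmf.expectation (randomizer x) (\<lambda>M. real (size M)) = 16 * real s + 1"
    by simp
qed

end

section \<open>Choice of parameters\<close>

theorem theorem2:
  fixes c :: real
  assumes "c > 0"
  shows "\<exists>C::real. C > 0 \<and>
    (\<forall>(n::nat) (\<epsilon>::real). n \<ge> 2 \<and> 0 < \<epsilon> \<and> \<epsilon> \<le> c \<longrightarrow>
      (\<exists>(R :: (bool, bool) randomizer) (A :: bool analyst).
         dp_shuffle n \<epsilon> R \<and>
         (\<forall>D. length D = n \<longrightarrow> finite_mse R A D \<and> rmse R A D \<le> C / \<epsilon>) \<and>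
         (\<forall>x. integrable (measure_pmf (R x)) (\<lambda>M. real (size M)) \<and>
              measure_pmf.expectation (R x) (\<lambda>M. real (size M)) \<le> C * (ln (real n) / \<epsilon>))))"
proof (intro exI[of _ "34 * (22 + c)"] conjI allI impI)
  show "0 < 34 * (22 + c)"
    using assms by simp
  fix n :: nat and \<epsilon> :: real
  assume "n \<ge> 2 \<and> 0 < \<epsilon> \<and> \<epsilon> \<le> c"
  then have n: "n \<ge> 2" and eps: "0 < \<epsilon>" "\<epsilon> \<le> c"
    by auto
  \<comment> \<open>Since \<open>q ^ s\<close> is \<open>exp (- s * \<epsilon> / 2)\<close>, the
    factor 22 yields the exponent 11 of \<open>q_small\<close>.\<close>
  define s where "s = nat \<lceil>22 * ln (real n) / \<epsilon>\<rceil>"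
  define q where "q = exp (- (\<epsilon> / 2))"
  have ln_n: "0 < ln (real n)" "ln (real n) \<le> real n"
    using n ln_le_minus_one[of "real n"] by auto
  have ln_2: "1 / 2 \<le> ln (real n)"
  proof -
    have "ln 2 \<le> ln (real n)"
      using n by (subst ln_le_cancel_iff) auto
    then show ?thesis
      using ln2_ge_two_thirds by linarith
  qed
  have pos: "0 < 22 * ln (real n) / \<epsilon>"
    using ln_n eps by simp
  have s_ge: "22 * ln (real n) / \<epsilon> \<le> real s" and s_le: "real s \<le> 22 * ln (real n) / \<epsilon> + 1"
  proof -
    have "real s = of_int \<lceil>22 * ln (real n) / \<epsilon>\<rceil>"
      using pos by (simp add: s_def)
    then show "22 * ln (real n) / \<epsilon> \<le> real s" "real s \<le> 22 * ln (real n) / \<epsilon> + 1"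
      by (simp_all only: le_of_int_ceiling of_int_ceiling_le_add_one)
  qed
  interpret noise_parameters n s q
  proof
    show "n \<ge> 2" by fact
    show "s > 0"
      using s_ge pos by linarith
    show "0 < q" "q < 1"
      using eps by (simp_all add: q_def)
    have "q ^ s = exp (- (real s * (\<epsilon> / 2)))"
      by (simp add: q_def exp_of_nat_mult[symmetric])
    also have "\<dots> \<le> exp (- (11 * ln (real n)))"
      using s_ge eps by (simp add: field_simps)
    also have "\<dots> = 1 / real n ^ 11"
      using n exp_of_nat_mult[of 11 "ln (real n)"] by (simp add: exp_minus inverse_eq_divide)
    finally show "q ^ s * real n ^ 11 \<le> 1"
      using n by (simp add: field_simps)
  qed
  have privacy: "ln (1 / q\<^sup>2) = \<epsilon>"
    by (simp add: q_def ln_div ln_realpow exp_double[symmetric] flip: exp_of_nat_mult)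
  have msg: "16 * real s + 1 \<le> 34 * (22 + c) * (ln (real n) / \<epsilon>)"
  proof -
    \<comment> \<open>From \<open>ln n \<ge> 1/2\<close> and \<open>c / \<epsilon> \<ge> 1\<close>,
      an additive constant becomes a multiple of \<open>c * ln n / \<epsilon>\<close>.\<close>
    have "(1::real) = (1 / 2) * (2 * 1)"
      by simp
    also have "\<dots> \<le> ln (real n) * (2 * (c / \<epsilon>))"
      using ln_2 eps by (intro mult_mono) (auto simp: pos_le_divide_eq)
    finally have "1 \<le> 2 * c * (ln (real n) / \<epsilon>)"
      by (simp add: mult_ac)
    moreover have "real s \<le> 22 * (ln (real n) / \<epsilon>) + 1" "0 \<le> ln (real n) / \<epsilon>"
      using s_le ln_n eps by simp_all
    \<comment> \<open>Rounding \<open>s\<close> up leaves the constant \<open>16 + 1 = 17\<close>,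
      absorbed with the factor \<open>2 * c\<close>, hence 34; the main coefficient 352 is enlarged
      to \<open>748 = 34 * 22\<close>.\<close>
    ultimately have "16 * real s + 1 \<le> 748 * (ln (real n) / \<epsilon>) + 17 * (2 * c * (ln (real n) / \<epsilon>))"
      by linarith
    also have "\<dots> = 34 * (22 + c) * (ln (real n) / \<epsilon>)"
      by (simp only: distrib_left distrib_right)
    finally show ?thesis .
  qed
  have error: "rmse randomizer analyst D \<le> 34 * (22 + c) / \<epsilon>" if "length D = n" for D
  proof -
    have one_minus_q: "\<epsilon> / (2 + c) \<le> 1 - q"
    proof -
      have "q \<le> 1 / (1 + \<epsilon> / 2)"
        using exp_ge_add_one_self[of "\<epsilon> / 2"] eps
        by (simp add: q_def exp_minus inverse_eq_divide le_imp_inverse_le frac_le)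
      then have "\<epsilon> / (2 + \<epsilon>) \<le> 1 - q"
        using eps by (simp add: field_simps)
      moreover have "\<epsilon> / (2 + c) \<le> \<epsilon> / (2 + \<epsilon>)"
        using eps by (intro divide_left_mono) auto
      ultimately show ?thesis by linarith
    qed
    have "1 / (1 - q) \<le> (22 + c) / \<epsilon>"
    proof -
      have "1 / (1 - q) \<le> 1 / (\<epsilon> / (2 + c))"
        using one_minus_q eps q by (intro divide_left_mono mult_pos_pos) auto
      also have "\<dots> \<le> (22 + c) / \<epsilon>"
        using eps by (simp add: divide_right_mono)
      finally show ?thesis .
    qed
    then have "(1 / (1 - q))\<^sup>2 \<le> ((22 + c) / \<epsilon>)\<^sup>2"
      using q by (intro power_mono) auto
    then have first: "6 / (1 - q)\<^sup>2 \<le> 6 * ((22 + c) / \<epsilon>)\<^sup>2"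
      by (simp add: power_one_over)
    \<comment> \<open>Here \<open>ln n \<le> n\<close> suffices: the plateau error is of no larger
      order than the narrow noise.\<close>
    have "real s / real n \<le> (22 + c) / \<epsilon>"
    proof -
      have "real s \<le> 22 * real n / \<epsilon> + 1"
        using s_le ln_n(2) eps divide_right_mono[of "22 * ln (real n)" "22 * real n" \<epsilon>] by linarith
      also have "1 \<le> real n * (c / \<epsilon>)"
        using n eps mult_mono[of 1 "real n" 1 "c / \<epsilon>"] by simp
      finally have "real s \<le> (22 + c) / \<epsilon> * real n"
        by (simp add: algebra_simps add_divide_distrib)
      then show ?thesis
        using n by (simp add: pos_divide_le_eq)
    qed
    then have "(real s / real n)\<^sup>2 \<le> ((22 + c) / \<epsilon>)\<^sup>2"
      by (intro power_mono) auto
    with first mse_protocol_le[OF that] have "mse randomizer analyst D \<le> 168 * ((22 + c) / \<epsilon>)\<^sup>2"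
      by linarith
    \<comment> \<open>\<open>168 = 6 + 162\<close>; the constant 34 is dictated by the number of
      messages, not by the error.\<close>
    also have "\<dots> \<le> 34\<^sup>2 * ((22 + c) / \<epsilon>)\<^sup>2"
      by (intro mult_right_mono) auto
    also have "\<dots> = (34 * (22 + c) / \<epsilon>)\<^sup>2"
      by (simp only: power_mult_distrib[symmetric] times_divide_eq_right)
    finally show ?thesis
      unfolding rmse_def using eps assms by (intro real_le_lsqrt) auto
  qed
  show "\<exists>(R :: (bool, bool) randomizer) (A :: bool analyst).
         dp_shuffle n \<epsilon> R \<and>
         (\<forall>D. length D = n \<longrightarrow> finite_mse R A D \<and> rmse R A D \<le> 34 * (22 + c) / \<epsilon>) \<and>
         (\<forall>x. integrable (measure_pmf (R x)) (\<lambda>M. real (size M)) \<and>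
              measure_pmf.expectation (R x) (\<lambda>M. real (size M)) \<le> 34 * (22 + c) * (ln (real n) / \<epsilon>))"
    using dp_shuffle_randomizer finite_mse_protocol error expected_messages msg
    unfolding privacy by (intro exI[of _ randomizer] exI[of _ analyst]) auto
qed

end
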